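(* Let $(\epsilon,\omega)\in\{(0,0),(0,1),(1,0),(-1,0)\}\cup\{(1,\alpha_+):\alpha_+>0\}\cup\{(-1,\alpha_-):\alpha_->0\}$, and consider the galilean kinematical Klein pair with $(d+1)$-dimensional spatial isotropy whose commutators (besides those with $\mathbf J$) are $[\mathbf K,H]=\mathbf P$, $[H,\mathbf P]=\epsilon\,\mathbf K+\omega\,\mathbf P$. Then the dimensional reduction to $d$-dimensional spatial isotropy followed by the İnönü–Wigner contraction along $\mathfrak g=\mathfrak k\oplus\mathfrak i$, with $\mathfrak k=H\oplus\mathbf P\oplus\mathbf K\oplus\mathbf J$ and $\mathfrak i=M\oplus C\oplus\mathbf D$, yields the projectable triplet $(\mathfrak g,\mathfrak h,\mathfrak i)$, with $\mathfrak g=M\oplus H\oplus C\oplus\mathbf P\oplus\mathbf D\oplus\mathbf K\oplus\mathbf J$, $\mathfrak h=C\oplus\mathbf D\oplus\mathbf K\oplus\mathbf J$, whose non-trivial commutators (besides those with $\mathbf J$) are $$[\mathbf D,\mathbf K]=C,\quad [\mathbf K,H]=\mathbf P,\quad [\mathbf D,\mathbf P]=M,\quad [C,H]=M,\quad [H,M]=\epsilon\, C+\omega\, M,\quad [H,\mathbf P]=\epsilon\,\mathbf K+\omega\,\mathbf P,$$ and which lifts the galilean kinematical Klein pair with the same $(\epsilon,\omega)$ and $d$-dimensional spatial isotropy.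
   Context: A Klein pair is a pair $(\mathfrak g,\mathfrak h)$ of a real Lie algebra and a Lie subalgebra; it is effective if $\mathfrak h$ contains no non-zero ideal of $\mathfrak g$. A projectable triplet $(\mathfrak g,\mathfrak h,\mathfrak i)$ is an effective Klein pair $(\mathfrak g,\mathfrak h)$ with a non-trivial ideal $\mathfrak i\subset\mathfrak g$ such that, with $\mathfrak j=\mathfrak h\cap\mathfrak i$, the quotient Klein pair $(\mathfrak g/\mathfrak i,\mathfrak h/\mathfrak j)$ is effective; one says that it lifts any Klein pair isomorphic to $(\mathfrak g/\mathfrak i,\mathfrak h/\mathfrak j)$. A kinematical Klein pair with $n$-dimensional spatial isotropy has $\mathfrak g$ with basis $H,P_\mu,K_\mu,J_{\mu\nu}=-J_{\nu\mu}$ (indices taking $n$ values), $[J_{\mu\nu},J_{\rho\sigma}]=\delta_{\nu\rho}J_{\mu\sigma}-\delta_{\nu\sigma}J_{\mu\rho}+\delta_{\mu\sigma}J_{\nu\rho}-\delta_{\mu\rho}J_{\nu\sigma}$, $[J_{\mu\nu},V_\rho]=-\delta_{\mu\rho}V_\nu+\delta_{\nu\rho}V_\mu$ for $V=P,K$, $[J_{\mu\nu},H]=0$, and $\mathfrak h=\mathbf K\oplus\mathbf J$. Boldface letters denote the spans of the corresponding generators. Shorthand: $[\mathbf K,H]=\mathbf P$ means $[K_\mu,H]=P_\mu$; $[\mathbf D,\mathbf K]=C$ means $[D_i,K_j]=\delta_{ij}C$; etc. Dimensional reduction: for $n=d+1$, write $\mu\in\{0,i\}$ with $i\in\{1,\dots,d\}$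 and rename $H\mapsto H$, $P_0\mapsto M$, $P_i\mapsto P_i$, $K_0\mapsto C$, $K_i\mapsto K_i$, $J_{0i}\mapsto D_i$, $J_{ij}\mapsto J_{ij}$. This presents the same Klein pair with $\mathfrak g=M\oplus H\oplus C\oplus\mathbf P\oplus\mathbf D\oplus\mathbf K\oplus\mathbf J$ and $\mathfrak h=C\oplus\mathbf D\oplus\mathbf K\oplus\mathbf J$, where now $\mathbf J\simeq\mathfrak{so}(d)$; $\mathbf P,\mathbf D,\mathbf K$ are vector modules and $M,H,C$ scalars for $\mathfrak{so}(d)$. İnönü–Wigner contraction of $\mathfrak g$ along a vector space splitting $\mathfrak g=\mathfrak k\oplus\mathfrak i$, with $\mathfrak k$ a subalgebra: the Lie algebra on the same vector space whose bracket is obtained from that of $\mathfrak g$ by setting to zero the $\mathfrak k$-component of $[\mathfrak k,\mathfrak i]$ and all of $[\mathfrak i,\mathfrak i]$, keeping $[\mathfrak k,\mathfrak k]\subset\mathfrak k$ and the $\mathfrak i$-component of $[\mathfrak k,\mathfrak i]$. *)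

theory Defs
  imports "HOL-Algebra.Algebraic_Closure_Type"
begin

section \<open>Real Lie algebras with an explicit carrier\<close>

text \<open>A real Lie algebra is a HOL-Algebra module over the ring of real numbers with a bracket.
  The carrier is explicit because quotients live on types of cosets. The fields
  \<open>mult\<close> and \<open>one\<close>, which every \<open>module\<close> record inherits, play no role.\<close>

abbreviation real_ring :: "real ring" where
  "real_ring \<equiv> ring_of_type_algebra"

record 'a lie_algebra = "(real, 'a) module" +
  bracket :: "'a \<Rightarrow> 'a \<Rightarrow> 'a"  (\<open>\<lbrakk>_,/ _\<rbrakk>\<index>\<close>)

locale lie_algebra = module real_ring L for L :: "'a lie_algebra" (structure) +
  assumes bracket_closed:
      "\<And>x y. x \<in> carrier L \<Longrightarrow> y \<in> carrier L \<Longrightarrow> \<lbrakk>x, y\<rbrakk> \<in> carrier L"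
    and bracket_add_left:
      "\<And>x y z. x \<in> carrier L \<Longrightarrow> y \<in> carrier L \<Longrightarrow> z \<in> carrier L \<Longrightarrow>
        \<lbrakk>x \<oplus>\<^bsub>L\<^esub> y, z\<rbrakk> = \<lbrakk>x, z\<rbrakk> \<oplus>\<^bsub>L\<^esub> \<lbrakk>y, z\<rbrakk>"
    and bracket_add_right:
      "\<And>x y z. x \<in> carrier L \<Longrightarrow> y \<in> carrier L \<Longrightarrow> z \<in> carrier L \<Longrightarrow>
        \<lbrakk>x, y \<oplus>\<^bsub>L\<^esub> z\<rbrakk> = \<lbrakk>x, y\<rbrakk> \<oplus>\<^bsub>L\<^esub> \<lbrakk>x, z\<rbrakk>"
    and bracket_smult_left:
      "\<And>a x y. x \<in> carrier L \<Longrightarrow> y \<in> carrier L \<Longrightarrow> \<lbrakk>a \<odot>\<^bsub>L\<^esub> x, y\<rbrakk> = a \<odot>\<^bsub>L\<^esub> \<lbrakk>x, y\<rbrakk>"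
    and bracket_smult_right:
      "\<And>a x y. x \<in> carrier L \<Longrightarrow> y \<in> carrier L \<Longrightarrow> \<lbrakk>x, a \<odot>\<^bsub>L\<^esub> y\<rbrakk> = a \<odot>\<^bsub>L\<^esub> \<lbrakk>x, y\<rbrakk>"
    and bracket_self: "\<And>x. x \<in> carrier L \<Longrightarrow> \<lbrakk>x, x\<rbrakk> = \<zero>\<^bsub>L\<^esub>"
    and jacobi:
      "\<And>x y z. x \<in> carrier L \<Longrightarrow> y \<in> carrier L \<Longrightarrow> z \<in> carrier L \<Longrightarrow>
        \<lbrakk>x, \<lbrakk>y, z\<rbrakk>\<rbrakk> \<oplus>\<^bsub>L\<^esub> \<lbrakk>y, \<lbrakk>z, x\<rbrakk>\<rbrakk> \<oplus>\<^bsub>L\<^esub> \<lbrakk>z, \<lbrakk>x, y\<rbrakk>\<rbrakk> = \<zero>\<^bsub>L\<^esub>"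

context
  fixes L :: "'a lie_algebra" (structure)
begin

abbreviation lin_subspace :: "'a set \<Rightarrow> bool" where
  "lin_subspace V \<equiv> submodule V real_ring L"

definition lin_span :: "'a set \<Rightarrow> 'a set" where
  "lin_span S = lin_subspace hull S"

text \<open>A finite family \<open>E\<close> indexed by \<open>B\<close>; linear independence of the family makes
  \<open>E\<close> injective on \<open>B\<close>.\<close>

definition is_basis :: "'i set \<Rightarrow> ('i \<Rightarrow> 'a) \<Rightarrow> bool" where
  "is_basis B E \<longleftrightarrow> finite B \<and> E \<in> B \<rightarrow> carrier L \<and> lin_span (E ` B) = carrier L \<and>
    (\<forall>c :: 'i \<Rightarrow> real. (\<Oplus>b\<in>B. c b \<odot> E b) = \<zero> \<longrightarrow> (\<forall>b\<in>B. c b = 0))"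

definition lie_subalgebra :: "'a set \<Rightarrow> bool" where
  "lie_subalgebra V \<longleftrightarrow> lin_subspace V \<and> (\<forall>x\<in>V. \<forall>y\<in>V. \<lbrakk>x, y\<rbrakk> \<in> V)"

definition lie_ideal :: "'a set \<Rightarrow> bool" where
  "lie_ideal V \<longleftrightarrow> lin_subspace V \<and> (\<forall>x\<in>carrier L. \<forall>y\<in>V. \<lbrakk>x, y\<rbrakk> \<in> V)"

text \<open>The quotient by \<open>I\<close> on the set of cosets; \<open>mult\<close> and \<open>one\<close> are given irrelevant values.\<close>

definition lie_quotient :: "'a set \<Rightarrow> 'a set lie_algebra" where
  "lie_quotient I =
    \<lparr>carrier = a_rcosets I, monoid.mult = (\<lambda>_ _. I), one = I, ring.zero = I, add = set_add L,
     module.smult = (\<lambda>a A. \<Union>x\<in>A. I +> (a \<odot> x)),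
     bracket = (\<lambda>A B. \<Union>x\<in>A. \<Union>y\<in>B. I +> \<lbrakk>x, y\<rbrakk>)\<rparr>"

text \<open>The image of \<open>V\<close> in the quotient by \<open>I\<close>; for a subspace \<open>V\<close> it is
  \<open>V/(V \<inter> I)\<close>, viewed inside the quotient.\<close>

definition quotient_image :: "'a set \<Rightarrow> 'a set \<Rightarrow> 'a set set" where
  "quotient_image I V = (\<lambda>x. I +> x) ` V"

section \<open>Klein pairs\<close>

definition klein_pair :: "'a set \<Rightarrow> bool" where
  "klein_pair hh \<longleftrightarrow> lie_algebra L \<and> lie_subalgebra hh"

definition effective_klein_pair :: "'a set \<Rightarrow> bool" where
  "effective_klein_pair hh \<longleftrightarrow>
    klein_pair hh \<and> (\<forall>V. lie_ideal V \<and> V \<subseteq> hh \<longrightarrow> V = {\<zero>})"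

section \<open>Inonu-Wigner contractions\<close>

definition splitting :: "'a set \<Rightarrow> 'a set \<Rightarrow> bool" where
  "splitting kk ii \<longleftrightarrow>
    lin_subspace kk \<and> lin_subspace ii \<and> kk \<inter> ii = {\<zero>} \<and> kk <+> ii = carrier L"

text \<open>The component of \<open>x\<close> in \<open>V\<close>; meaningful when \<open>V\<close> and \<open>W\<close> split the carrier.\<close>

definition component :: "'a set \<Rightarrow> 'a set \<Rightarrow> 'a \<Rightarrow> 'a" where
  "component V W x = (THE v. v \<in> V \<and> (\<exists>w\<in>W. x = v \<oplus> w))"

definition iw_contraction :: "'a set \<Rightarrow> 'a set \<Rightarrow> 'a lie_algebra" where
  "iw_contraction kk ii = L\<lparr>bracket := (\<lambda>x y.
     let xk = component kk ii x; xi = component ii kk x;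
         yk = component kk ii y; yi = component ii kk y
     in \<lbrakk>xk, yk\<rbrakk> \<oplus> component ii kk \<lbrakk>xk, yi\<rbrakk> \<oplus> component ii kk \<lbrakk>xi, yk\<rbrakk>)\<rparr>"

section \<open>Generators and modules for rotations\<close>

definition rotations :: "nat set \<Rightarrow> (nat \<Rightarrow> nat \<Rightarrow> 'a) \<Rightarrow> bool" where
  "rotations I J \<longleftrightarrow>
    (\<forall>\<mu>\<in>I. \<forall>\<nu>\<in>I. J \<mu> \<nu> \<in> carrier L \<and> J \<mu> \<nu> = \<ominus> J \<nu> \<mu>) \<and>
    (\<forall>\<mu>\<in>I. \<forall>\<nu>\<in>I. \<forall>\<rho>\<in>I. \<forall>\<sigma>\<in>I. \<lbrakk>J \<mu> \<nu>, J \<rho> \<sigma>\<rbrakk> =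
      of_bool (\<nu> = \<rho>) \<odot> J \<mu> \<sigma> \<ominus> of_bool (\<nu> = \<sigma>) \<odot> J \<mu> \<rho>
      \<oplus> of_bool (\<mu> = \<sigma>) \<odot> J \<nu> \<rho> \<ominus> of_bool (\<mu> = \<rho>) \<odot> J \<nu> \<sigma>)"

definition vector_module :: "nat set \<Rightarrow> (nat \<Rightarrow> nat \<Rightarrow> 'a) \<Rightarrow> (nat \<Rightarrow> 'a) \<Rightarrow> bool" where
  "vector_module I J V \<longleftrightarrow> (\<forall>\<mu>\<in>I. \<forall>\<nu>\<in>I. \<forall>\<rho>\<in>I. \<lbrakk>J \<mu> \<nu>, V \<rho>\<rbrakk> =
      \<ominus> (of_bool (\<mu> = \<rho>) \<odot> V \<nu>) \<oplus> of_bool (\<nu> = \<rho>) \<odot> V \<mu>)"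

definition scalar_module :: "nat set \<Rightarrow> (nat \<Rightarrow> nat \<Rightarrow> 'a) \<Rightarrow> 'a \<Rightarrow> bool" where
  "scalar_module I J S \<longleftrightarrow> (\<forall>\<mu>\<in>I. \<forall>\<nu>\<in>I. \<lbrakk>J \<mu> \<nu>, S\<rbrakk> = \<zero>)"

end

definition klein_isomorphic ::
    "'a lie_algebra \<Rightarrow> 'a set \<Rightarrow> 'b lie_algebra \<Rightarrow> 'b set \<Rightarrow> bool" where
  "klein_isomorphic L hh N hh' \<longleftrightarrow>
    (\<exists>f. bij_betw f (carrier L) (carrier N) \<and> f ` hh = hh' \<and>
      (\<forall>x\<in>carrier L. \<forall>y\<in>carrier L. f (x \<oplus>\<^bsub>L\<^esub> y) = f x \<oplus>\<^bsub>N\<^esub> f y) \<and>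
      (\<forall>a. \<forall>x\<in>carrier L. f (a \<odot>\<^bsub>L\<^esub> x) = a \<odot>\<^bsub>N\<^esub> f x) \<and>
      (\<forall>x\<in>carrier L. \<forall>y\<in>carrier L. f \<lbrakk>x, y\<rbrakk>\<^bsub>L\<^esub> = \<lbrakk>f x, f y\<rbrakk>\<^bsub>N\<^esub>))"

definition projectable_triplet :: "'a lie_algebra \<Rightarrow> 'a set \<Rightarrow> 'a set \<Rightarrow> bool" where
  "projectable_triplet L hh ii \<longleftrightarrow>
    effective_klein_pair L hh \<and> lie_ideal L ii \<and> ii \<noteq> {\<zero>\<^bsub>L\<^esub>} \<and> ii \<noteq> carrier L \<and>
    effective_klein_pair (lie_quotient L ii) (quotient_image L ii hh)"

definition lifts ::
    "'a lie_algebra \<Rightarrow> 'a set \<Rightarrow> 'a set \<Rightarrow> 'b lie_algebra \<Rightarrow> 'b set \<Rightarrow> bool" where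
  "lifts L hh ii N hh' \<longleftrightarrow> projectable_triplet L hh ii \<and> klein_pair N hh' \<and>
    klein_isomorphic (lie_quotient L ii) (quotient_image L ii hh) N hh'"

section \<open>Kinematical and galilean Klein pairs\<close>

text \<open>The spatial indices range over a finite set \<open>I\<close> of naturals; the dimension of the spatial
  isotropy is \<open>card I\<close>. Generators are families indexed by the following labels.\<close>

datatype kin_label = kH | kP nat | kK nat | kJ nat nat

definition kin_labels :: "nat set \<Rightarrow> kin_label set" where
  "kin_labels I = {kH} \<union> kP ` I \<union> kK ` I \<union> {kJ \<mu> \<nu> | \<mu> \<nu>. \<mu> \<in> I \<and> \<nu> \<in> I \<and> \<mu> < \<nu>}"

definition kinematical_klein_pair ::
    "'a lie_algebra \<Rightarrow> nat set \<Rightarrow> 'a set \<Rightarrow> (kin_label \<Rightarrow> 'a) \<Rightarrow> bool" where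
  "kinematical_klein_pair L I hh E \<longleftrightarrow>
    klein_pair L hh \<and> is_basis L (kin_labels I) E \<and>
    hh = lin_span L (E ` (kin_labels I - ({kH} \<union> kP ` I))) \<and>
    rotations L I (\<lambda>\<mu> \<nu>. E (kJ \<mu> \<nu>)) \<and>
    vector_module L I (\<lambda>\<mu> \<nu>. E (kJ \<mu> \<nu>)) (\<lambda>\<mu>. E (kP \<mu>)) \<and>
    vector_module L I (\<lambda>\<mu> \<nu>. E (kJ \<mu> \<nu>)) (\<lambda>\<mu>. E (kK \<mu>)) \<and>
    scalar_module L I (\<lambda>\<mu> \<nu>. E (kJ \<mu> \<nu>)) (E kH)"

definition galilean_klein_pair ::
    "real \<Rightarrow> real \<Rightarrow> 'a lie_algebra \<Rightarrow> nat set \<Rightarrow> 'a set \<Rightarrow> (kin_label \<Rightarrow> 'a) \<Rightarrow> bool" where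
  "galilean_klein_pair \<epsilon> \<omega> L I hh E \<longleftrightarrow>
    kinematical_klein_pair L I hh E \<and>
    (\<forall>\<mu>\<in>I. \<lbrakk>E (kK \<mu>), E kH\<rbrakk>\<^bsub>L\<^esub> = E (kP \<mu>) \<and>
            \<lbrakk>E kH, E (kP \<mu>)\<rbrakk>\<^bsub>L\<^esub> = \<epsilon> \<odot>\<^bsub>L\<^esub> E (kK \<mu>) \<oplus>\<^bsub>L\<^esub> \<omega> \<odot>\<^bsub>L\<^esub> E (kP \<mu>)) \<and>
    (\<forall>\<mu>\<in>I. \<forall>\<nu>\<in>I. \<lbrakk>E (kK \<mu>), E (kK \<nu>)\<rbrakk>\<^bsub>L\<^esub> = \<zero>\<^bsub>L\<^esub> \<and>
                  \<lbrakk>E (kK \<mu>), E (kP \<nu>)\<rbrakk>\<^bsub>L\<^esub> = \<zero>\<^bsub>L\<^esub> \<and>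
                  \<lbrakk>E (kP \<mu>), E (kP \<nu>)\<rbrakk>\<^bsub>L\<^esub> = \<zero>\<^bsub>L\<^esub>)"

section \<open>Dimensional reduction\<close>

datatype red_label = rM | rH | rC | rP nat | rD nat | rK nat | rJ nat nat

fun reduced_label :: "red_label \<Rightarrow> kin_label" where
  "reduced_label rM = kP 0"
| "reduced_label rH = kH"
| "reduced_label rC = kK 0"
| "reduced_label (rP i) = kP i"
| "reduced_label (rD i) = kJ 0 i"
| "reduced_label (rK i) = kK i"
| "reduced_label (rJ i j) = kJ i j"

text \<open>For spatial indices \<open>{0..d}\<close>, the index \<open>0\<close> is singled out and the generators
  renamed, leaving the vector indices \<open>{1..d}\<close>. Only labels change; the Klein pair does not.\<close>

definition dim_reduction :: "(kin_label \<Rightarrow> 'a) \<Rightarrow> red_label \<Rightarrow> 'a" where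
  "dim_reduction E = E \<circ> reduced_label"

definition rJ_labels :: "nat \<Rightarrow> red_label set" where
  "rJ_labels d = {rJ i j | i j. i \<in> {1..d} \<and> j \<in> {1..d} \<and> i < j}"

definition red_labels :: "nat \<Rightarrow> red_label set" where
  "red_labels d = {rM, rH, rC} \<union> rP ` {1..d} \<union> rD ` {1..d} \<union> rK ` {1..d} \<union> rJ_labels d"

definition red_labels_h :: "nat \<Rightarrow> red_label set" where
  "red_labels_h d = {rC} \<union> rD ` {1..d} \<union> rK ` {1..d} \<union> rJ_labels d"

definition red_labels_k :: "nat \<Rightarrow> red_label set" where
  "red_labels_k d = {rH} \<union> rP ` {1..d} \<union> rK ` {1..d} \<union> rJ_labels d"

definition red_labels_i :: "nat \<Rightarrow> red_label set" where
  "red_labels_i d = {rM, rC} \<union> rD ` {1..d}"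

definition reduced_klein_pair ::
    "'a lie_algebra \<Rightarrow> nat \<Rightarrow> 'a set \<Rightarrow> (red_label \<Rightarrow> 'a) \<Rightarrow> bool" where
  "reduced_klein_pair L d hh Y \<longleftrightarrow>
    klein_pair L hh \<and> is_basis L (red_labels d) Y \<and>
    hh = lin_span L (Y ` red_labels_h d) \<and>
    (let I = {1..d}; J = (\<lambda>i j. Y (rJ i j)) in
      rotations L I J \<and>
      vector_module L I J (\<lambda>i. Y (rP i)) \<and>
      vector_module L I J (\<lambda>i. Y (rD i)) \<and>
      vector_module L I J (\<lambda>i. Y (rK i)) \<and>
      scalar_module L I J (Y rM) \<and>
      scalar_module L I J (Y rH) \<and>
      scalar_module L I J (Y rC))"

text \<open>All brackets not involving rotations, up to antisymmetry, including those that vanish.\<close>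

definition contracted_commutators ::
    "real \<Rightarrow> real \<Rightarrow> 'a lie_algebra \<Rightarrow> nat \<Rightarrow> (red_label \<Rightarrow> 'a) \<Rightarrow> bool" where
  "contracted_commutators \<epsilon> \<omega> L d Y \<longleftrightarrow>
    (let M = Y rM; H = Y rH; C = Y rC;
         P = (\<lambda>i. Y (rP i)); D = (\<lambda>i. Y (rD i)); K = (\<lambda>i. Y (rK i)) in
      \<lbrakk>C, H\<rbrakk>\<^bsub>L\<^esub> = M \<and>
      \<lbrakk>H, M\<rbrakk>\<^bsub>L\<^esub> = \<epsilon> \<odot>\<^bsub>L\<^esub> C \<oplus>\<^bsub>L\<^esub> \<omega> \<odot>\<^bsub>L\<^esub> M \<and>
      \<lbrakk>M, C\<rbrakk>\<^bsub>L\<^esub> = \<zero>\<^bsub>L\<^esub> \<and>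
      (\<forall>i\<in>{1..d}.
        \<lbrakk>K i, H\<rbrakk>\<^bsub>L\<^esub> = P i \<and>
        \<lbrakk>H, P i\<rbrakk>\<^bsub>L\<^esub> = \<epsilon> \<odot>\<^bsub>L\<^esub> K i \<oplus>\<^bsub>L\<^esub> \<omega> \<odot>\<^bsub>L\<^esub> P i \<and>
        (\<forall>j\<in>{1..d}. \<lbrakk>D i, K j\<rbrakk>\<^bsub>L\<^esub> = of_bool (i = j) \<odot>\<^bsub>L\<^esub> C \<and>
                    \<lbrakk>D i, P j\<rbrakk>\<^bsub>L\<^esub> = of_bool (i = j) \<odot>\<^bsub>L\<^esub> M)) \<and>
      (\<forall>i\<in>{1..d}.
        \<lbrakk>M, P i\<rbrakk>\<^bsub>L\<^esub> = \<zero>\<^bsub>L\<^esub> \<and> \<lbrakk>M, D i\<rbrakk>\<^bsub>L\<^esub> = \<zero>\<^bsub>L\<^esub> \<and> \<lbrakk>M, K i\<rbrakk>\<^bsub>L\<^esub> = \<zero>\<^bsub>L\<^esub> \<and>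
        \<lbrakk>C, P i\<rbrakk>\<^bsub>L\<^esub> = \<zero>\<^bsub>L\<^esub> \<and> \<lbrakk>C, D i\<rbrakk>\<^bsub>L\<^esub> = \<zero>\<^bsub>L\<^esub> \<and> \<lbrakk>C, K i\<rbrakk>\<^bsub>L\<^esub> = \<zero>\<^bsub>L\<^esub> \<and>
        \<lbrakk>H, D i\<rbrakk>\<^bsub>L\<^esub> = \<zero>\<^bsub>L\<^esub>) \<and>
      (\<forall>i\<in>{1..d}. \<forall>j\<in>{1..d}.
        \<lbrakk>P i, P j\<rbrakk>\<^bsub>L\<^esub> = \<zero>\<^bsub>L\<^esub> \<and> \<lbrakk>K i, K j\<rbrakk>\<^bsub>L\<^esub> = \<zero>\<^bsub>L\<^esub> \<and> \<lbrakk>D i, D j\<rbrakk>\<^bsub>L\<^esub> = \<zero>\<^bsub>L\<^esub> \<and>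
        \<lbrakk>K i, P j\<rbrakk>\<^bsub>L\<^esub> = \<zero>\<^bsub>L\<^esub>))"

end

theory Submission
  imports Defs
begin

text \<open>In the galilean algebra with index set \<open>{0..d}\<close> the bracket already satisfies
  \<open>[kk, ii] \<subseteq> ii\<close>, so the contraction merely kills \<open>[ii, ii]\<close>; for any splitting with
  \<open>kk\<close> a subalgebra the result is the semidirect product of \<open>kk\<close> with the abelian
  ideal \<open>ii\<close>, and the Jacobi identity is a projection of the original one. Effectiveness of
  \<open>hh\<close> holds because every generator of \<open>hh\<close> is detected by bracketing with \<open>H\<close> or some
  \<open>P\<^sub>j\<close> and reading off a coordinate outside \<open>hh\<close>. The quotient by \<open>ii\<close> has the galilean
  structure constants with respect to the images of the remaining generators, and two Klein
  pairs with the same structure constants are isomorphic by matching bases.\<close>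

section \<open>Linear algebra in a Lie algebra with explicit carrier\<close>

text \<open>The non-zero brackets of generators that the contraction removes are
  \<open>[D_i, D_j] = - J_ij\<close>, \<open>[D_i, M] = - P_i\<close> and
  \<open>[D_i, C] = - K_i\<close>, where two labels containing the index 0 meet. Every other
  relation is an original one with an index set to 0; for instance \<open>[D_i, K_j]\<close> is
  \<open>[J_0i, K_j]\<close>, with value \<open>K_0 = C\<close> for \<open>i = j\<close> and zero
  otherwise. Effectiveness is not inherited by a contraction, because new ideals may appear:
  \<open>ii\<close> becomes one, and apart from the single direction \<open>M\<close> it lies in
  \<open>hh\<close>. What keeps \<open>C\<close> and the \<open>D_i\<close> from forming an ideal
  inside \<open>hh\<close> is that \<open>[C, H]\<close> and \<open>[D_i, P_i]\<close> both equal
  \<open>M\<close>. The linear algebra runs on coordinate functionals: they certify independence,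
  separate spans, detect generators and define the isomorphism. The recurring bookkeeping problem is
  that a basis contains \<open>J_ij\<close> only for \<open>i < j\<close>, while the relations range
  over all pairs of indices; antisymmetry, which also forces \<open>J_ii = 0\<close>, closes this
  gap.\<close>

lemma real_ring_simps [simp]:
  "carrier real_ring = UNIV" "\<zero>\<^bsub>real_ring\<^esub> = 0" "\<one>\<^bsub>real_ring\<^esub> = 1"
  "a \<oplus>\<^bsub>real_ring\<^esub> b = a + b" "a \<otimes>\<^bsub>real_ring\<^esub> b = a * b"
  by (simp_all add: ring_of_type_algebra_def)

lemma real_ring_minus [simp]: "\<ominus>\<^bsub>real_ring\<^esub> a = - a"
proof -
  interpret cring real_ring by (rule cring_from_type_algebra)
  show ?thesis using minus_equality[of "- a" a] by simp
qed

context lie_algebra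
begin

lemma smult_in_carrier [simp]: "x \<in> carrier L \<Longrightarrow> a \<odot> x \<in> carrier L"
  by simp

lemma smult_add_scalar: "x \<in> carrier L \<Longrightarrow> (a + b) \<odot> x = a \<odot> x \<oplus>\<^bsub>L\<^esub> b \<odot> x"
  using smult_l_distr[of a b x] by simp

lemma smult_add: "x \<in> carrier L \<Longrightarrow> y \<in> carrier L \<Longrightarrow> a \<odot> (x \<oplus>\<^bsub>L\<^esub> y) = a \<odot> x \<oplus>\<^bsub>L\<^esub> a \<odot> y"
  using smult_r_distr[of a x y] by simp

lemma smult_smult: "x \<in> carrier L \<Longrightarrow> a \<odot> (b \<odot> x) = (a * b) \<odot> x"
  using smult_assoc1[of a b x] by simp

lemma smult_1 [simp]: "x \<in> carrier L \<Longrightarrow> 1 \<odot> x = x"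
  using smult_one[of x] by simp

lemma smult_0 [simp]: "x \<in> carrier L \<Longrightarrow> 0 \<odot> x = \<zero>\<^bsub>L\<^esub>"
  using smult_l_null[of x] by simp

lemma smult_zero [simp]: "a \<odot> \<zero>\<^bsub>L\<^esub> = \<zero>\<^bsub>L\<^esub>"
  using smult_r_null[of a] by simp

lemma smult_minus_1: "x \<in> carrier L \<Longrightarrow> (- 1) \<odot> x = \<ominus>\<^bsub>L\<^esub> x"
  using smult_l_minus[of 1 x] by simp

lemma minus_zero_carrier [simp]: "\<ominus>\<^bsub>L\<^esub> \<zero>\<^bsub>L\<^esub> = \<zero>\<^bsub>L\<^esub>"
  using smult_minus_1[of "\<zero>\<^bsub>L\<^esub>"] by simp

lemma smult_of_bool: "x \<in> carrier L \<Longrightarrow> of_bool p \<odot> x = (if p then x else \<zero>\<^bsub>L\<^esub>)"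
  by simp

lemma bracket_in_carrier [simp]:
  "x \<in> carrier L \<Longrightarrow> y \<in> carrier L \<Longrightarrow> \<lbrakk>x, y\<rbrakk> \<in> carrier L"
  by (rule bracket_closed)

lemma bracket_zero_left [simp]: "x \<in> carrier L \<Longrightarrow> \<lbrakk>\<zero>\<^bsub>L\<^esub>, x\<rbrakk> = \<zero>\<^bsub>L\<^esub>"
  using bracket_smult_left[of "\<zero>\<^bsub>L\<^esub>" x 0] by simp

lemma bracket_zero_right [simp]: "x \<in> carrier L \<Longrightarrow> \<lbrakk>x, \<zero>\<^bsub>L\<^esub>\<rbrakk> = \<zero>\<^bsub>L\<^esub>"
  using bracket_smult_right[of x "\<zero>\<^bsub>L\<^esub>" 0] by simp

text \<open>Polarise \<open>bracket_self\<close>: expanding the bracket of x + y with itself leaves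
  only the two mixed terms.\<close>

lemma bracket_swap:
  assumes "x \<in> carrier L" "y \<in> carrier L"
  shows "\<lbrakk>x, y\<rbrakk> = \<ominus>\<^bsub>L\<^esub> \<lbrakk>y, x\<rbrakk>"
proof -
  have "\<zero>\<^bsub>L\<^esub> = \<lbrakk>x \<oplus>\<^bsub>L\<^esub> y, x \<oplus>\<^bsub>L\<^esub> y\<rbrakk>"
    using assms by (simp add: bracket_self)
  also have "\<dots> = (\<lbrakk>x, x\<rbrakk> \<oplus>\<^bsub>L\<^esub> \<lbrakk>y, x\<rbrakk>) \<oplus>\<^bsub>L\<^esub> (\<lbrakk>x, y\<rbrakk> \<oplus>\<^bsub>L\<^esub> \<lbrakk>y, y\<rbrakk>)"
    using assms by (simp only: bracket_add_left bracket_add_right M.a_closed)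
  finally have "\<lbrakk>x, y\<rbrakk> \<oplus>\<^bsub>L\<^esub> \<lbrakk>y, x\<rbrakk> = \<zero>\<^bsub>L\<^esub>"
    using assms by (simp add: bracket_self M.a_comm)
  then show ?thesis
    using assms M.minus_equality[of "\<lbrakk>x, y\<rbrakk>" "\<lbrakk>y, x\<rbrakk>"] by simp
qed

lemma subspaceI:
  assumes "V \<subseteq> carrier L" "\<zero>\<^bsub>L\<^esub> \<in> V" "\<And>x y. x \<in> V \<Longrightarrow> y \<in> V \<Longrightarrow> x \<oplus>\<^bsub>L\<^esub> y \<in> V"
    and smult: "\<And>a x. x \<in> V \<Longrightarrow> a \<odot> x \<in> V"
  shows "lin_subspace L V"
proof (rule submoduleI)
  show "\<ominus>\<^bsub>L\<^esub> x \<in> V" if "x \<in> V" for x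
    using smult[OF that, of "- 1"] that assms(1) by (simp add: smult_minus_1 subset_iff)
qed (use assms in auto)

lemma subspaceD:
  assumes "lin_subspace L V"
  shows "V \<subseteq> carrier L" "\<zero>\<^bsub>L\<^esub> \<in> V"
    "\<And>x y. x \<in> V \<Longrightarrow> y \<in> V \<Longrightarrow> x \<oplus>\<^bsub>L\<^esub> y \<in> V"
    "\<And>a x. x \<in> V \<Longrightarrow> a \<odot> x \<in> V"
    "\<And>x. x \<in> V \<Longrightarrow> \<ominus>\<^bsub>L\<^esub> x \<in> V"
    "\<And>x. x \<in> V \<Longrightarrow> x \<in> carrier L"
proof -
  note E = submoduleE[OF assms]
  show *: "V \<subseteq> carrier L" by (rule E(1))
  obtain v where v: "v \<in> V" using E(2) by auto
  then have "0 \<odot> v \<in> V" using E(4) by simp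
  then show "\<zero>\<^bsub>L\<^esub> \<in> V" using v * by (simp add: subset_iff)
qed (use submoduleE[OF assms] in auto)

lemma span_superset: "S \<subseteq> lin_span L S"
  by (simp add: lin_span_def hull_subset)

lemma span_base: "x \<in> S \<Longrightarrow> x \<in> lin_span L S"
  using span_superset by blast

text \<open>The assumption on \<open>S\<close> matters: if \<open>S\<close> left the carrier, no
  submodule would contain it and the hull, an empty intersection, would be
  \<open>UNIV\<close>.\<close>

lemma span_subspace:
  assumes "S \<subseteq> carrier L"
  shows "lin_subspace L (lin_span L S)"
proof (rule subspaceI)
  show "lin_span L S \<subseteq> carrier L"
    unfolding lin_span_def using assms carrier_is_submodule by (rule hull_minimal)
qed (auto simp: lin_span_def hull_def dest: subspaceD)

lemma span_minimal: "S \<subseteq> V \<Longrightarrow> lin_subspace L V \<Longrightarrow> lin_span L S \<subseteq> V"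
  unfolding lin_span_def by (rule hull_minimal)

lemma span_le_span: "S \<subseteq> lin_span L T \<Longrightarrow> T \<subseteq> carrier L \<Longrightarrow> lin_span L S \<subseteq> lin_span L T"
  by (intro span_minimal span_subspace)

text \<open>The elements of the carrier with property \<open>P\<close> form a subspace containing
  \<open>S\<close>. The inductive cases receive membership in the carrier because the module and
  bracket laws hold only there.\<close>

lemma span_induct [consumes 2, case_names base zero add smult]:
  assumes x: "x \<in> lin_span L S" and S: "S \<subseteq> carrier L"
    and "\<And>s. s \<in> S \<Longrightarrow> P s" and "P \<zero>\<^bsub>L\<^esub>"
    and "\<And>x y. x \<in> carrier L \<Longrightarrow> y \<in> carrier L \<Longrightarrow> P x \<Longrightarrow> P y \<Longrightarrow> P (x \<oplus>\<^bsub>L\<^esub> y)"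
    and "\<And>a x. x \<in> carrier L \<Longrightarrow> P x \<Longrightarrow> P (a \<odot> x)"
  shows "P x"
proof -
  have "lin_subspace L {x \<in> carrier L. P x}"
    by (rule subspaceI) (use assms in auto)
  then have "lin_span L S \<subseteq> {x \<in> carrier L. P x}"
    by (rule span_minimal[rotated]) (use assms in auto)
  then show ?thesis using x by auto
qed

text \<open>Bilinearity, used one argument at a time: induction on \<open>y\<close> with a generator
  on the left, then induction on \<open>x\<close>.\<close>

lemma bracket_span_in_subspace:
  assumes V: "lin_subspace L V" and S: "S \<subseteq> carrier L" and T: "T \<subseteq> carrier L"
    and gen: "\<And>s t. s \<in> S \<Longrightarrow> t \<in> T \<Longrightarrow> \<lbrakk>s, t\<rbrakk> \<in> V"
    and x: "x \<in> lin_span L S" and y: "y \<in> lin_span L T"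
  shows "\<lbrakk>x, y\<rbrakk> \<in> V"
proof -
  note VD = subspaceD[OF V]
  have base: "\<lbrakk>s, y\<rbrakk> \<in> V" if s: "s \<in> S" for s
    using y T
  proof (induction rule: span_induct)
    case (add x y)
    then show ?case using s S VD by (simp add: bracket_add_right subset_iff)
  next
    case (smult a x)
    then show ?case using s S VD by (simp add: bracket_smult_right subset_iff)
  next
    case zero
    then show ?case using s S VD by (simp add: subset_iff)
  qed (use s gen in auto)
  have yc: "y \<in> carrier L" using y subspaceD(6)[OF span_subspace[OF T]] by auto
  from x S show ?thesis
  proof (induction rule: span_induct)
    case (add u v)
    then show ?case using yc VD by (simp add: bracket_add_left)
  next
    case (smult a u)
    then show ?case using yc VD by (simp add: bracket_smult_left)
  next
    case zero
    then show ?case using yc VD by simp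
  qed (rule base)
qed

text \<open>Independence is certified by dual functionals: applying \<open>\<phi> b\<close> to a
  vanishing combination leaves just the coefficient \<open>c b\<close>.\<close>

lemma is_basisI:
  fixes \<phi> :: "'i \<Rightarrow> 'a \<Rightarrow> real"
  assumes B: "finite B" "E \<in> B \<rightarrow> carrier L" "lin_span L (E ` B) = carrier L"
    and add: "\<And>b x y. b \<in> B \<Longrightarrow> x \<in> carrier L \<Longrightarrow> y \<in> carrier L \<Longrightarrow> \<phi> b (x \<oplus>\<^bsub>L\<^esub> y) = \<phi> b x + \<phi> b y"
    and smult: "\<And>b a x. b \<in> B \<Longrightarrow> x \<in> carrier L \<Longrightarrow> \<phi> b (a \<odot> x) = a * \<phi> b x"
    and dual: "\<And>b b'. b \<in> B \<Longrightarrow> b' \<in> B \<Longrightarrow> \<phi> b (E b') = of_bool (b = b')"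
  shows "is_basis L B E"
proof -
  have zero: "\<phi> b \<zero>\<^bsub>L\<^esub> = 0" if "b \<in> B" for b
    using smult[OF that, of "\<zero>\<^bsub>L\<^esub>" 0] by simp
  have sum: "\<phi> b (\<Oplus>\<^bsub>L\<^esub>b\<in>S. c b \<odot> E b) = (\<Sum>b'\<in>S. c b' * \<phi> b (E b'))"
    if "finite S" "S \<subseteq> B" "b \<in> B" for S c b
    using that
  proof (induction S rule: finite_induct)
    case (insert s S)
    then have "E s \<in> carrier L" "(\<lambda>b. c b \<odot> E b) \<in> S \<rightarrow> carrier L"
      using B(2) by (auto simp: Pi_iff intro!: smult_in_carrier)
    with insert show ?case by (simp add: M.finsum_insert add smult)
  qed (simp add: zero)
  have "c b = 0" if "(\<Oplus>\<^bsub>L\<^esub>b\<in>B. c b \<odot> E b) = \<zero>\<^bsub>L\<^esub>" "b \<in> B" for c b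
  proof -
    have "0 = (\<Sum>b'\<in>B. c b' * of_bool (b = b'))"
      using sum[OF B(1) order_refl that(2), of c] that zero dual by (simp cong: sum.cong)
    also have "\<dots> = c b" using B(1) that(2) by (simp add: sum.delta if_distrib of_bool_def cong: if_cong)
    finally show ?thesis by simp
  qed
  then show ?thesis using B by (auto simp: is_basis_def)
qed

end

section \<open>Coordinates with respect to a basis\<close>

locale lie_algebra_basis = lie_algebra +
  fixes B :: "'i set" and E :: "'i \<Rightarrow> 'a"
  assumes basis: "is_basis L B E"
begin

lemma finite_B: "finite B"
  and E_carrier: "b \<in> B \<Longrightarrow> E b \<in> carrier L"
  and span_E: "lin_span L (E ` B) = carrier L"
  and independent: "(\<Oplus>\<^bsub>L\<^esub>b\<in>B. c b \<odot> E b) = \<zero>\<^bsub>L\<^esub> \<Longrightarrow> b \<in> B \<Longrightarrow> c b = 0"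
  using basis by (auto simp: is_basis_def)

lemma E_image_carrier: "S \<subseteq> B \<Longrightarrow> E ` S \<subseteq> carrier L"
  using E_carrier by auto

definition lincomb :: "('i \<Rightarrow> real) \<Rightarrow> 'a" where
  "lincomb c = (\<Oplus>\<^bsub>L\<^esub>b\<in>B. c b \<odot> E b)"

lemma lincomb_carrier: "lincomb c \<in> carrier L"
  unfolding lincomb_def by (rule M.finsum_closed) (use E_carrier in auto)

lemma lincomb_add: "lincomb (\<lambda>b. c b + d b) = lincomb c \<oplus>\<^bsub>L\<^esub> lincomb d"
proof -
  have "lincomb (\<lambda>b. c b + d b) = (\<Oplus>\<^bsub>L\<^esub>b\<in>B. c b \<odot> E b \<oplus>\<^bsub>L\<^esub> d b \<odot> E b)"
    unfolding lincomb_def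
    by (rule M.finsum_cong') (use E_carrier smult_add_scalar in auto)
  then show ?thesis
    unfolding lincomb_def using M.finsum_addf E_carrier by (simp add: Pi_iff)
qed

lemma lincomb_smult: "lincomb (\<lambda>b. a * c b) = a \<odot> lincomb c"
proof -
  have "a \<odot> lincomb c = (\<Oplus>\<^bsub>L\<^esub>b\<in>B. a \<odot> (c b \<odot> E b))"
    unfolding lincomb_def
    by (rule finsum_smult_ldistr) (use E_carrier finite_B in auto)
  also have "\<dots> = lincomb (\<lambda>b. a * c b)"
    unfolding lincomb_def
    by (rule M.finsum_cong') (use E_carrier smult_smult in auto)
  finally show ?thesis by simp
qed

lemma lincomb_of_bool:
  assumes "b \<in> B"
  shows "lincomb (\<lambda>b'. of_bool (b = b')) = E b"
proof -
  have "lincomb (\<lambda>b'. of_bool (b = b')) = (\<Oplus>\<^bsub>L\<^esub>b'\<in>B. if b = b' then E b' else \<zero>\<^bsub>L\<^esub>)"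
    unfolding lincomb_def
    by (rule M.finsum_cong') (use E_carrier in \<open>auto simp: smult_of_bool\<close>)
  also have "\<dots> = E b"
    by (rule M.finsum_singleton) (use assms finite_B E_carrier in auto)
  finally show ?thesis .
qed

lemma lincomb_zero: "lincomb (\<lambda>_. 0) = \<zero>\<^bsub>L\<^esub>"
  using lincomb_smult[of 0 "\<lambda>_. 0"] lincomb_carrier by simp

lemma lincomb_surj:
  assumes "x \<in> carrier L"
  shows "\<exists>c. x = lincomb c"
proof -
  have "x \<in> lin_span L (E ` B)" using assms by (simp add: span_E)
  then show ?thesis using E_image_carrier[OF order_refl]
  proof (induction rule: span_induct)
    case (base s)
    then obtain b where "b \<in> B" "s = E b" by auto
    then show ?case using lincomb_of_bool[of b] by (intro exI[of _ "\<lambda>b'. of_bool (b = b')"]) simp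
  next
    case zero
    show ?case by (intro exI[of _ "\<lambda>_. 0"]) (simp add: lincomb_zero)
  next
    case (add x y)
    then obtain c d where "x = lincomb c" "y = lincomb d" by auto
    then show ?case by (intro exI[of _ "\<lambda>b. c b + d b"]) (simp add: lincomb_add)
  next
    case (smult a x)
    then obtain c where "x = lincomb c" by auto
    then show ?case by (intro exI[of _ "\<lambda>b. a * c b"]) (simp add: lincomb_smult)
  qed
qed

text \<open>The coefficient family of a vector is determined only on \<open>B\<close>; elsewhere the
  choice is arbitrary, which is why the facts about single coordinates ask for an index in
  \<open>B\<close>.\<close>

definition coord :: "'a \<Rightarrow> 'i \<Rightarrow> real" where
  "coord x = (SOME c. x = lincomb c)"

lemma lincomb_coord: "x \<in> carrier L \<Longrightarrow> lincomb (coord x) = x"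
  unfolding coord_def by (rule someI2_ex[OF lincomb_surj]) auto

lemma lincomb_cong: "(\<And>b. b \<in> B \<Longrightarrow> c b = c' b) \<Longrightarrow> lincomb c = lincomb c'"
  unfolding lincomb_def by (rule M.finsum_cong') (use E_carrier in auto)

lemma lincomb_inj:
  assumes "lincomb c = lincomb c'" "b \<in> B"
  shows "c b = c' b"
proof -
  have "lincomb (\<lambda>b. c b + (- 1) * c' b) = lincomb c \<oplus>\<^bsub>L\<^esub> \<ominus>\<^bsub>L\<^esub> lincomb c'"
    by (simp only: lincomb_add lincomb_smult smult_minus_1[OF lincomb_carrier])
  also have "\<dots> = \<zero>\<^bsub>L\<^esub>"
    using assms(1) lincomb_carrier by (simp add: M.r_neg)
  finally show ?thesis
    using independent[of "\<lambda>b. c b + (- 1) * c' b" b] assms(2) by (simp add: lincomb_def)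
qed

lemma coord_eqI: "x = lincomb c \<Longrightarrow> b \<in> B \<Longrightarrow> coord x b = c b"
  using lincomb_inj[of "coord x" c b] lincomb_coord[of x] lincomb_carrier[of c] by simp

lemma coord_add:
  "x \<in> carrier L \<Longrightarrow> y \<in> carrier L \<Longrightarrow> b \<in> B \<Longrightarrow> coord (x \<oplus>\<^bsub>L\<^esub> y) b = coord x b + coord y b"
  by (rule coord_eqI) (simp_all add: lincomb_add lincomb_coord)

lemma coord_smult: "x \<in> carrier L \<Longrightarrow> b \<in> B \<Longrightarrow> coord (a \<odot> x) b = a * coord x b"
  by (rule coord_eqI) (simp_all add: lincomb_smult lincomb_coord)

lemma coord_E: "b \<in> B \<Longrightarrow> b' \<in> B \<Longrightarrow> coord (E b') b = of_bool (b' = b)"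
  by (rule coord_eqI) (simp_all add: lincomb_of_bool)

lemma coord_zero: "b \<in> B \<Longrightarrow> coord \<zero>\<^bsub>L\<^esub> b = 0"
  by (rule coord_eqI) (simp_all add: lincomb_zero)

lemma coord_minus: "x \<in> carrier L \<Longrightarrow> b \<in> B \<Longrightarrow> coord (\<ominus>\<^bsub>L\<^esub> x) b = - coord x b"
  using coord_smult[of x b "- 1"] by (simp add: smult_minus_1)

lemma zero_if_coord_zero:
  assumes "x \<in> carrier L" "\<And>b. b \<in> B \<Longrightarrow> coord x b = 0"
  shows "x = \<zero>\<^bsub>L\<^esub>"
  using lincomb_cong[of "coord x" "\<lambda>_. 0"] assms by (simp add: lincomb_coord lincomb_zero)

text \<open>A coordinate functional is linear and kills every generator with a different index. This
  separates spans of disjoint parts of the basis, and it drives the arguments on effectiveness,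
  splittings and quotients.\<close>

lemma coord_span_zero:
  assumes "x \<in> lin_span L (E ` S)" "S \<subseteq> B" "b \<in> B - S"
  shows "coord x b = 0"
  using assms(1) E_image_carrier[OF assms(2)]
proof (induction rule: span_induct)
  case (base s)
  then show ?case using assms coord_E by auto
qed (use assms in \<open>auto simp: coord_zero coord_add coord_smult\<close>)

text \<open>The coordinates along \<open>g b\<close> serve as the dual functionals.\<close>

lemma is_basis_reindex:
  assumes "bij_betw g B' B"
  shows "is_basis L B' (E \<circ> g)"
proof (rule is_basisI[where \<phi> = "\<lambda>b x. coord x (g b)"])
  have g: "g ` B' = B" "inj_on g B'" using assms by (auto simp: bij_betw_def)
  show "finite B'" using assms bij_betw_finite finite_B by blast
  show "lin_span L ((E \<circ> g) ` B') = carrier L" using g span_E by (simp only: image_comp[symmetric])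
  show "E \<circ> g \<in> B' \<rightarrow> carrier L" using g E_carrier by auto
  show "coord ((E \<circ> g) b') (g b) = of_bool (b = b')" if "b \<in> B'" "b' \<in> B'" for b b'
    using that g coord_E[of "g b" "g b'"] by (auto dest: inj_onD)
qed (use assms coord_add coord_smult in \<open>auto simp: bij_betw_def\<close>)

text \<open>For \<open>x\<close> in an ideal inside the span, the bracket with \<open>y\<close>
  stays in that ideal, so its coordinate at \<open>t\<close> outside \<open>S\<close> vanishes. By
  \<open>detect\<close> this coordinate is the coordinate of \<open>x\<close> at \<open>s\<close>,
  hence all coordinates of \<open>x\<close> vanish.\<close>

lemma effective_klein_pairI:
  assumes sub: "lie_subalgebra L (lin_span L (E ` S))" and S: "S \<subseteq> B"
    and detect: "\<And>s. s \<in> S \<Longrightarrow> \<exists>y\<in>carrier L. \<exists>t\<in>B - S. \<forall>s'\<in>S. coord \<lbrakk>E s', y\<rbrakk> t = of_bool (s' = s)"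
  shows "effective_klein_pair L (lin_span L (E ` S))"
proof -
  note SD = subspaceD[OF span_subspace[OF E_image_carrier[OF S]]]
  have "V = {\<zero>\<^bsub>L\<^esub>}" if V: "lie_ideal L V" "V \<subseteq> lin_span L (E ` S)" for V
  proof -
    have Vs: "lin_subspace L V" using V by (simp add: lie_ideal_def)
    note VD = subspaceD[OF Vs]
    have "x = \<zero>\<^bsub>L\<^esub>" if x: "x \<in> V" for x
    proof (rule zero_if_coord_zero)
      show "x \<in> carrier L" using x VD by auto
      fix b assume b: "b \<in> B"
      show "coord x b = 0"
      proof (cases "b \<in> S")
        case False
        then show ?thesis using coord_span_zero[of x S b] x V b S by auto
      next
        case True
        then obtain y t where y: "y \<in> carrier L" and t: "t \<in> B" "t \<notin> S"
          and yt: "\<forall>s'\<in>S. coord \<lbrakk>E s', y\<rbrakk> t = of_bool (s' = b)"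
          using detect[OF True] by auto
        have "x \<in> lin_span L (E ` S)" using x V by auto
        \<comment> \<open>Both sides are linear in \<open>x\<close>, so agreement on the generators
          of the span suffices; there it is the detection hypothesis.\<close>
        then have "coord \<lbrakk>x, y\<rbrakk> t = coord x b" using E_image_carrier[OF S]
        proof (induction rule: span_induct)
          case (base s)
          then show ?case using yt coord_E b S by auto
        qed (use y t b in \<open>auto simp: coord_add coord_smult coord_zero bracket_add_left bracket_smult_left\<close>)
        moreover have "\<lbrakk>x, y\<rbrakk> \<in> V"
          using V x y VD bracket_swap[of x y] by (auto simp: lie_ideal_def)
        then have "coord \<lbrakk>x, y\<rbrakk> t = 0"
          using coord_span_zero[of "\<lbrakk>x, y\<rbrakk>" S t] V t S by auto
        ultimately show ?thesis by simp
      qed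
    qed
    then show ?thesis using VD(2) by blast
  qed
  moreover have "lie_algebra L" ..
  ultimately show ?thesis using sub by (auto simp: effective_klein_pair_def klein_pair_def)
qed

end

section \<open>Contractions\<close>

text \<open>The description in \<open>component\<close> is unambiguous: two decompositions differ by
  a vector, \<open>v' - v = w - w'\<close>, that lies in both summands and so is zero.\<close>

lemma (in lie_algebra) component_add:
  assumes VW: "splitting L V W" and v: "v \<in> V" and w: "w \<in> W"
  shows "component L V W (v \<oplus>\<^bsub>L\<^esub> w) = v"
  unfolding component_def
proof (rule the_equality)
  show "v \<in> V \<and> (\<exists>w'\<in>W. v \<oplus>\<^bsub>L\<^esub> w = v \<oplus>\<^bsub>L\<^esub> w')" using v w by auto
  fix v' assume "v' \<in> V \<and> (\<exists>w'\<in>W. v \<oplus>\<^bsub>L\<^esub> w = v' \<oplus>\<^bsub>L\<^esub> w')"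
  then obtain w' where v': "v' \<in> V" and w': "w' \<in> W" and eq: "v \<oplus>\<^bsub>L\<^esub> w = v' \<oplus>\<^bsub>L\<^esub> w'" by auto
  note VD = subspaceD[of V] and WD = subspaceD[of W]
  have S: "lin_subspace L V" "lin_subspace L W" "V \<inter> W = {\<zero>\<^bsub>L\<^esub>}"
    using VW by (auto simp: splitting_def)
  have c: "v \<in> carrier L" "v' \<in> carrier L" "w \<in> carrier L" "w' \<in> carrier L"
    using S v v' w w' VD(6) WD(6) by auto
  have "\<ominus>\<^bsub>L\<^esub> v \<oplus>\<^bsub>L\<^esub> v' = \<ominus>\<^bsub>L\<^esub> v \<oplus>\<^bsub>L\<^esub> (v' \<oplus>\<^bsub>L\<^esub> w') \<oplus>\<^bsub>L\<^esub> \<ominus>\<^bsub>L\<^esub> w'"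
    using c by (simp add: M.a_assoc M.r_neg)
  also have "\<dots> = w \<oplus>\<^bsub>L\<^esub> \<ominus>\<^bsub>L\<^esub> w'"
    using c by (simp add: eq[symmetric] M.r_neg1)
  finally have "\<ominus>\<^bsub>L\<^esub> v \<oplus>\<^bsub>L\<^esub> v' \<in> W"
    using S w w' WD(3,5) by simp
  moreover have "\<ominus>\<^bsub>L\<^esub> v \<oplus>\<^bsub>L\<^esub> v' \<in> V"
    using S v v' VD(3,5) by simp
  ultimately have "\<ominus>\<^bsub>L\<^esub> v \<oplus>\<^bsub>L\<^esub> v' \<in> V \<inter> W" by simp
  then have "\<ominus>\<^bsub>L\<^esub> v \<oplus>\<^bsub>L\<^esub> v' = \<zero>\<^bsub>L\<^esub>" using S by auto
  then show "v' = v"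
    using c M.r_neg2[of v v'] by simp
qed

text \<open>Makes \<open>component_add\<close> available for the second summand as well.\<close>

lemma (in lie_algebra) splitting_sym:
  assumes "splitting L V W"
  shows "splitting L W V"
proof -
  have S: "lin_subspace L V" "lin_subspace L W" "V \<inter> W = {\<zero>\<^bsub>L\<^esub>}" "V <+>\<^bsub>L\<^esub> W = carrier L"
    using assms by (auto simp: splitting_def)
  have "W <+>\<^bsub>L\<^esub> V = V <+>\<^bsub>L\<^esub> W"
    using subspaceD(6)[OF S(1)] subspaceD(6)[OF S(2)] M.a_comm by (auto simp: set_add_def') metis+
  then show ?thesis using S by (auto simp: splitting_def)
qed

text \<open>The nine terms form a 3 by 3 array whose rows are a, b, c. The hypotheses say that its
  three cyclic diagonals sum to zero, which is the pattern in which Jacobi identities appear for the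
  contracted bracket.\<close>

lemma (in lie_algebra) add_rearrange:
  assumes "{a1, a2, a3, b1, b2, b3, c1, c2, c3} \<subseteq> carrier L"
    and "a1 \<oplus>\<^bsub>L\<^esub> b2 \<oplus>\<^bsub>L\<^esub> c3 = \<zero>\<^bsub>L\<^esub>" "a2 \<oplus>\<^bsub>L\<^esub> b3 \<oplus>\<^bsub>L\<^esub> c1 = \<zero>\<^bsub>L\<^esub>" "a3 \<oplus>\<^bsub>L\<^esub> b1 \<oplus>\<^bsub>L\<^esub> c2 = \<zero>\<^bsub>L\<^esub>"
  shows "(a1 \<oplus>\<^bsub>L\<^esub> a2 \<oplus>\<^bsub>L\<^esub> a3) \<oplus>\<^bsub>L\<^esub> (b1 \<oplus>\<^bsub>L\<^esub> b2 \<oplus>\<^bsub>L\<^esub> b3) \<oplus>\<^bsub>L\<^esub> (c1 \<oplus>\<^bsub>L\<^esub> c2 \<oplus>\<^bsub>L\<^esub> c3) = \<zero>\<^bsub>L\<^esub>"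
proof -
  have "(a1 \<oplus>\<^bsub>L\<^esub> a2 \<oplus>\<^bsub>L\<^esub> a3) \<oplus>\<^bsub>L\<^esub> (b1 \<oplus>\<^bsub>L\<^esub> b2 \<oplus>\<^bsub>L\<^esub> b3) \<oplus>\<^bsub>L\<^esub> (c1 \<oplus>\<^bsub>L\<^esub> c2 \<oplus>\<^bsub>L\<^esub> c3) =
    (a1 \<oplus>\<^bsub>L\<^esub> b2 \<oplus>\<^bsub>L\<^esub> c3) \<oplus>\<^bsub>L\<^esub> (a2 \<oplus>\<^bsub>L\<^esub> b3 \<oplus>\<^bsub>L\<^esub> c1) \<oplus>\<^bsub>L\<^esub> (a3 \<oplus>\<^bsub>L\<^esub> b1 \<oplus>\<^bsub>L\<^esub> c2)"
    using assms(1) by (simp add: M.a_ac)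
  then show ?thesis using assms by simp
qed

locale lie_splitting = lie_algebra +
  fixes kk ii :: "'a set"
  assumes split: "splitting L kk ii" and sub: "lie_subalgebra L kk"
begin

lemma kk: "lin_subspace L kk" and ii: "lin_subspace L ii"
  using split by (auto simp: splitting_def)

lemma kk_carrier [simp]: "x \<in> kk \<Longrightarrow> x \<in> carrier L"
  and ii_carrier [simp]: "x \<in> ii \<Longrightarrow> x \<in> carrier L"
  using subspaceD[OF kk] subspaceD[OF ii] by auto

lemma bracket_kk: "x \<in> kk \<Longrightarrow> y \<in> kk \<Longrightarrow> \<lbrakk>x, y\<rbrakk> \<in> kk"
  using sub by (auto simp: lie_subalgebra_def)

abbreviation pk :: "'a \<Rightarrow> 'a" where "pk \<equiv> component L kk ii"
abbreviation pi :: "'a \<Rightarrow> 'a" where "pi \<equiv> component L ii kk"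

lemma decompose:
  assumes "x \<in> carrier L"
  obtains u v where "u \<in> kk" "v \<in> ii" "x = u \<oplus>\<^bsub>L\<^esub> v"
proof -
  have "x \<in> kk <+>\<^bsub>L\<^esub> ii" using split assms by (simp add: splitting_def)
  then show thesis using that by (auto simp: set_add_def')
qed

lemma pk_add: "u \<in> kk \<Longrightarrow> v \<in> ii \<Longrightarrow> pk (u \<oplus>\<^bsub>L\<^esub> v) = u"
  by (rule component_add[OF split])

lemma pi_add: "u \<in> kk \<Longrightarrow> v \<in> ii \<Longrightarrow> pi (u \<oplus>\<^bsub>L\<^esub> v) = v"
  using component_add[OF splitting_sym[OF split], of v u] by (simp add: M.a_comm)

lemma pk_kk [simp]: "x \<in> kk \<Longrightarrow> pk x = x" and pi_kk [simp]: "x \<in> kk \<Longrightarrow> pi x = \<zero>\<^bsub>L\<^esub>"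
  using pk_add[of x "\<zero>\<^bsub>L\<^esub>"] pi_add[of x "\<zero>\<^bsub>L\<^esub>"] subspaceD(2)[OF ii] by simp_all

lemma pi_ii [simp]: "x \<in> ii \<Longrightarrow> pi x = x" and pk_ii [simp]: "x \<in> ii \<Longrightarrow> pk x = \<zero>\<^bsub>L\<^esub>"
  using pk_add[of "\<zero>\<^bsub>L\<^esub>" x] pi_add[of "\<zero>\<^bsub>L\<^esub>" x] subspaceD(2)[OF kk] by simp_all

lemma pk_in: "x \<in> carrier L \<Longrightarrow> pk x \<in> kk" and pi_in: "x \<in> carrier L \<Longrightarrow> pi x \<in> ii"
  by (metis decompose pk_add, metis decompose pi_add)

lemma pk_carrier [simp]: "x \<in> carrier L \<Longrightarrow> pk x \<in> carrier L"
  and pi_carrier [simp]: "x \<in> carrier L \<Longrightarrow> pi x \<in> carrier L"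
  using pk_in pi_in by auto

lemma pk_pi: "x \<in> carrier L \<Longrightarrow> pk x \<oplus>\<^bsub>L\<^esub> pi x = x"
  by (metis decompose pk_add pi_add)

lemma proj_distrib:
  assumes "x \<in> carrier L" "y \<in> carrier L"
  shows "pk (x \<oplus>\<^bsub>L\<^esub> y) = pk x \<oplus>\<^bsub>L\<^esub> pk y \<and> pi (x \<oplus>\<^bsub>L\<^esub> y) = pi x \<oplus>\<^bsub>L\<^esub> pi y"
proof -
  obtain u v where u: "u \<in> kk" "v \<in> ii" "x = u \<oplus>\<^bsub>L\<^esub> v" using assms decompose by blast
  obtain s t where s: "s \<in> kk" "t \<in> ii" "y = s \<oplus>\<^bsub>L\<^esub> t" using assms decompose by blast
  have "x \<oplus>\<^bsub>L\<^esub> y = (u \<oplus>\<^bsub>L\<^esub> s) \<oplus>\<^bsub>L\<^esub> (v \<oplus>\<^bsub>L\<^esub> t)"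
    using u s by (simp add: M.a_ac)
  then show ?thesis
    using u s subspaceD(3)[OF kk] subspaceD(3)[OF ii] by (simp add: pk_add pi_add)
qed

lemmas pk_plus = proj_distrib[THEN conjunct1] and pi_plus = proj_distrib[THEN conjunct2]

lemma proj_smult:
  assumes "x \<in> carrier L"
  shows "pk (a \<odot> x) = a \<odot> pk x \<and> pi (a \<odot> x) = a \<odot> pi x"
proof -
  obtain u v where u: "u \<in> kk" "v \<in> ii" "x = u \<oplus>\<^bsub>L\<^esub> v" using assms decompose by blast
  then have "a \<odot> x = a \<odot> u \<oplus>\<^bsub>L\<^esub> a \<odot> v" by (simp add: smult_add)
  then show ?thesis
    using u subspaceD(4)[OF kk] subspaceD(4)[OF ii] by (simp add: pk_add pi_add)
qed

lemmas pk_smult = proj_smult[THEN conjunct1] and pi_smult = proj_smult[THEN conjunct2]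

abbreviation G :: "'a lie_algebra" where "G \<equiv> iw_contraction L kk ii"

lemma contraction_simps [simp]:
  "carrier G = carrier L" "add G = add L" "ring.zero G = ring.zero L" "module.smult G = module.smult L"
  by (simp_all add: iw_contraction_def)

lemma contraction_bracket:
  "\<lbrakk>x, y\<rbrakk>\<^bsub>G\<^esub> = \<lbrakk>pk x, pk y\<rbrakk> \<oplus>\<^bsub>L\<^esub> pi \<lbrakk>pk x, pi y\<rbrakk> \<oplus>\<^bsub>L\<^esub> pi \<lbrakk>pi x, pk y\<rbrakk>"
  by (simp add: iw_contraction_def Let_def)

lemma contraction_bracket_kk: "x \<in> kk \<Longrightarrow> y \<in> kk \<Longrightarrow> \<lbrakk>x, y\<rbrakk>\<^bsub>G\<^esub> = \<lbrakk>x, y\<rbrakk>"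
  using subspaceD(2)[OF kk] by (simp add: contraction_bracket)

lemma contraction_bracket_ki: "x \<in> kk \<Longrightarrow> y \<in> ii \<Longrightarrow> \<lbrakk>x, y\<rbrakk>\<^bsub>G\<^esub> = pi \<lbrakk>x, y\<rbrakk>"
  using subspaceD(2)[OF kk] by (simp add: contraction_bracket)

lemma contraction_bracket_ik: "x \<in> ii \<Longrightarrow> y \<in> kk \<Longrightarrow> \<lbrakk>x, y\<rbrakk>\<^bsub>G\<^esub> = pi \<lbrakk>x, y\<rbrakk>"
  using subspaceD(2)[OF kk] by (simp add: contraction_bracket)

lemma contraction_bracket_ii: "x \<in> ii \<Longrightarrow> y \<in> ii \<Longrightarrow> \<lbrakk>x, y\<rbrakk>\<^bsub>G\<^esub> = \<zero>\<^bsub>L\<^esub>"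
  using subspaceD(2)[OF kk] by (simp add: contraction_bracket)

text \<open>The contraction alters only the bracket field, so every purely linear notion has the
  same meaning for \<open>G\<close> and for \<open>L\<close>.\<close>

lemma contraction_submodule [simp]: "lin_subspace G V \<longleftrightarrow> lin_subspace L V"
  by (simp add: submodule_def subgroup_def submodule_axioms_def)

lemma contraction_span [simp]: "lin_span G = lin_span L"
  by (simp add: fun_eq_iff lin_span_def)

lemma contraction_basis [simp]: "is_basis G = is_basis L"
  by (intro ext) (simp add: is_basis_def finsum_def)

lemma contraction_minus [simp]: "a_inv G = a_inv L"
  by (intro ext) (simp add: a_inv_def m_inv_def)

lemma contraction_minus2 [simp]: "a_minus G = a_minus L"
  by (intro ext) (simp add: a_minus_def)

text \<open>Since \<open>kk\<close> is a subalgebra, the bracket of \<open>x\<close> with the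
  \<open>kk\<close>-part of \<open>w\<close> lies in \<open>kk\<close> and is lost under
  \<open>pi\<close>. This allows the inner projections in iterated contracted brackets to be
  dropped.\<close>

lemma pi_bracket_pi:
  assumes "x \<in> kk" "w \<in> carrier L"
  shows "pi \<lbrakk>x, pi w\<rbrakk> = pi \<lbrakk>x, w\<rbrakk>"
proof -
  have "\<lbrakk>x, w\<rbrakk> = \<lbrakk>x, pk w\<rbrakk> \<oplus>\<^bsub>L\<^esub> \<lbrakk>x, pi w\<rbrakk>"
    using assms pk_pi[of w] by (simp add: bracket_add_right[symmetric])
  then show ?thesis
    using assms bracket_kk[OF assms(1) pk_in[OF assms(2)]] by (simp add: pi_plus)
qed

text \<open>The \<open>kk\<close>-part is the original double bracket, and the
  \<open>ii\<close>-part is the projection of those terms with exactly one entry from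
  \<open>ii\<close>. Terms with two or three such entries are gone.\<close>

lemma contraction_double_bracket:
  assumes "x \<in> carrier L" "y \<in> carrier L" "z \<in> carrier L"
  shows "\<lbrakk>x, \<lbrakk>y, z\<rbrakk>\<^bsub>G\<^esub>\<rbrakk>\<^bsub>G\<^esub> = \<lbrakk>pk x, \<lbrakk>pk y, pk z\<rbrakk>\<rbrakk> \<oplus>\<^bsub>L\<^esub>
    pi (\<lbrakk>pk x, \<lbrakk>pk y, pi z\<rbrakk>\<rbrakk> \<oplus>\<^bsub>L\<^esub> \<lbrakk>pk x, \<lbrakk>pi y, pk z\<rbrakk>\<rbrakk> \<oplus>\<^bsub>L\<^esub> \<lbrakk>pi x, \<lbrakk>pk y, pk z\<rbrakk>\<rbrakk>)"
proof -
  let ?w = "\<lbrakk>pk y, pi z\<rbrakk> \<oplus>\<^bsub>L\<^esub> \<lbrakk>pi y, pk z\<rbrakk>"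
  have yz: "\<lbrakk>y, z\<rbrakk>\<^bsub>G\<^esub> = \<lbrakk>pk y, pk z\<rbrakk> \<oplus>\<^bsub>L\<^esub> pi ?w"
    using assms by (simp add: contraction_bracket pi_plus M.a_assoc)
  have w: "?w \<in> carrier L" using assms by simp
  have "pk \<lbrakk>y, z\<rbrakk>\<^bsub>G\<^esub> = \<lbrakk>pk y, pk z\<rbrakk>" "pi \<lbrakk>y, z\<rbrakk>\<^bsub>G\<^esub> = pi ?w"
    unfolding yz using assms w by (simp_all add: pk_add pi_add bracket_kk pk_in pi_in)
  then have "\<lbrakk>x, \<lbrakk>y, z\<rbrakk>\<^bsub>G\<^esub>\<rbrakk>\<^bsub>G\<^esub> =
      \<lbrakk>pk x, \<lbrakk>pk y, pk z\<rbrakk>\<rbrakk> \<oplus>\<^bsub>L\<^esub> pi \<lbrakk>pk x, ?w\<rbrakk> \<oplus>\<^bsub>L\<^esub> pi \<lbrakk>pi x, \<lbrakk>pk y, pk z\<rbrakk>\<rbrakk>"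
    unfolding contraction_bracket[of x "\<lbrakk>y, z\<rbrakk>\<^bsub>G\<^esub>"]
    using pi_bracket_pi[OF pk_in[OF assms(1)] w] by simp
  then show ?thesis
    using assms by (simp add: bracket_add_right pi_plus M.a_assoc)
qed

lemma lie_algebra_contraction: "lie_algebra G"
proof (intro lie_algebra.intro lie_algebra_axioms.intro moduleI abelian_groupI)
  show "cring real_ring" by (rule cring_from_type_algebra)
  show "\<exists>y\<in>carrier G. y \<oplus>\<^bsub>G\<^esub> x = \<zero>\<^bsub>G\<^esub>" if "x \<in> carrier G" for x
    using that by (intro bexI[of _ "\<ominus>\<^bsub>L\<^esub> x"]) (simp_all add: M.l_neg)
  show "\<lbrakk>x, x\<rbrakk>\<^bsub>G\<^esub> = \<zero>\<^bsub>G\<^esub>" if "x \<in> carrier G" for x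
  proof -
    have x: "x \<in> carrier L" using that by simp
    \<comment> \<open>The two mixed terms of the contracted bracket of \<open>x\<close> with itself
      cancel, because \<open>pi\<close> is linear and so commutes with the sign from
      antisymmetry.\<close>
    have "pi \<lbrakk>pk x, pi x\<rbrakk> = \<ominus>\<^bsub>L\<^esub> pi \<lbrakk>pi x, pk x\<rbrakk>"
      using bracket_swap[of "pk x" "pi x"] pi_smult[of "\<lbrakk>pi x, pk x\<rbrakk>" "- 1"] x
      by (simp add: smult_minus_1)
    then show ?thesis
      using x by (simp add: contraction_bracket bracket_self M.l_neg)
  qed
  show "\<lbrakk>x, \<lbrakk>y, z\<rbrakk>\<^bsub>G\<^esub>\<rbrakk>\<^bsub>G\<^esub> \<oplus>\<^bsub>G\<^esub> \<lbrakk>y, \<lbrakk>z, x\<rbrakk>\<^bsub>G\<^esub>\<rbrakk>\<^bsub>G\<^esub> \<oplus>\<^bsub>G\<^esub> \<lbrakk>z, \<lbrakk>x, y\<rbrakk>\<^bsub>G\<^esub>\<rbrakk>\<^bsub>G\<^esub> = \<zero>\<^bsub>G\<^esub>"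
    if "x \<in> carrier G" "y \<in> carrier G" "z \<in> carrier G" for x y z
  proof -
    have c: "x \<in> carrier L" "y \<in> carrier L" "z \<in> carrier L" using that by auto
    define s where "s = (\<lambda>x y z. \<lbrakk>pk x, \<lbrakk>pk y, pi z\<rbrakk>\<rbrakk> \<oplus>\<^bsub>L\<^esub> \<lbrakk>pk x, \<lbrakk>pi y, pk z\<rbrakk>\<rbrakk> \<oplus>\<^bsub>L\<^esub> \<lbrakk>pi x, \<lbrakk>pk y, pk z\<rbrakk>\<rbrakk>)"
    have sc: "s x y z \<in> carrier L" "s y z x \<in> carrier L" "s z x y \<in> carrier L"
      using c by (simp_all add: s_def)
    \<comment> \<open>One original Jacobi identity for each position of the single
      \<open>ii\<close>-entry; their terms are the three cyclic diagonals of the array.\<close>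
    have "s x y z \<oplus>\<^bsub>L\<^esub> s y z x \<oplus>\<^bsub>L\<^esub> s z x y = \<zero>\<^bsub>L\<^esub>"
      unfolding s_def
      by (rule add_rearrange)
        (use c jacobi[of "pk x" "pk y" "pi z"] jacobi[of "pk x" "pi y" "pk z"] jacobi[of "pi x" "pk y" "pk z"]
          in simp_all)
    then have "pi (s x y z) \<oplus>\<^bsub>L\<^esub> pi (s y z x) \<oplus>\<^bsub>L\<^esub> pi (s z x y) = \<zero>\<^bsub>L\<^esub>"
      using sc subspaceD(2)[OF kk] by (simp add: pi_plus[symmetric])
    moreover have "\<lbrakk>pk x, \<lbrakk>pk y, pk z\<rbrakk>\<rbrakk> \<oplus>\<^bsub>L\<^esub> \<lbrakk>pk y, \<lbrakk>pk z, pk x\<rbrakk>\<rbrakk> \<oplus>\<^bsub>L\<^esub> \<lbrakk>pk z, \<lbrakk>pk x, pk y\<rbrakk>\<rbrakk> = \<zero>\<^bsub>L\<^esub>"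
      using c by (simp add: jacobi)
    moreover have "(p \<oplus>\<^bsub>L\<^esub> u) \<oplus>\<^bsub>L\<^esub> (q \<oplus>\<^bsub>L\<^esub> v) \<oplus>\<^bsub>L\<^esub> (r \<oplus>\<^bsub>L\<^esub> w) = (p \<oplus>\<^bsub>L\<^esub> q \<oplus>\<^bsub>L\<^esub> r) \<oplus>\<^bsub>L\<^esub> (u \<oplus>\<^bsub>L\<^esub> v \<oplus>\<^bsub>L\<^esub> w)"
      if "{p, q, r, u, v, w} \<subseteq> carrier L" for p q r u v w
      using that by (simp add: M.a_ac)
    moreover have "\<lbrakk>x, \<lbrakk>y, z\<rbrakk>\<^bsub>G\<^esub>\<rbrakk>\<^bsub>G\<^esub> = \<lbrakk>pk x, \<lbrakk>pk y, pk z\<rbrakk>\<rbrakk> \<oplus>\<^bsub>L\<^esub> pi (s x y z)"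
      if "x \<in> carrier L" "y \<in> carrier L" "z \<in> carrier L" for x y z
      unfolding s_def using that by (rule contraction_double_bracket)
    ultimately show ?thesis using c sc by simp
  qed
qed (simp_all add: contraction_bracket pk_plus pi_plus pk_smult pi_smult bracket_add_left bracket_add_right
      bracket_smult_left bracket_smult_right smult_add smult_add_scalar smult_smult M.a_ac)

lemma lie_ideal_contraction: "lie_ideal G ii"
  unfolding lie_ideal_def
proof (intro conjI ballI)
  show "lin_subspace G ii" using ii by simp
  fix x y assume "x \<in> carrier G" "y \<in> ii"
  \<comment> \<open>As the \<open>kk\<close>-part of \<open>y\<close> is zero, only the summand
    projected to \<open>ii\<close> with \<open>y\<close> on the right survives.\<close>
  then have "\<lbrakk>x, y\<rbrakk>\<^bsub>G\<^esub> = pi \<lbrakk>pk x, y\<rbrakk>" "\<lbrakk>pk x, y\<rbrakk> \<in> carrier L"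
    using subspaceD(2)[OF kk] by (simp_all add: contraction_bracket)
  then show "\<lbrakk>x, y\<rbrakk>\<^bsub>G\<^esub> \<in> ii" using pi_in by simp
qed

end

section \<open>Homomorphisms and quotients\<close>

locale lie_linear_map = dom: lie_algebra L + cod: lie_algebra N
  for L :: "'a lie_algebra" and N :: "'b lie_algebra" +
  fixes f :: "'a \<Rightarrow> 'b"
  assumes hom_closed [simp]: "x \<in> carrier L \<Longrightarrow> f x \<in> carrier N"
    and hom_add: "x \<in> carrier L \<Longrightarrow> y \<in> carrier L \<Longrightarrow> f (x \<oplus>\<^bsub>L\<^esub> y) = f x \<oplus>\<^bsub>N\<^esub> f y"
    and hom_smult: "x \<in> carrier L \<Longrightarrow> f (a \<odot>\<^bsub>L\<^esub> x) = a \<odot>\<^bsub>N\<^esub> f x"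
begin

lemma hom_zero: "f \<zero>\<^bsub>L\<^esub> = \<zero>\<^bsub>N\<^esub>"
  using hom_smult[of "\<zero>\<^bsub>L\<^esub>" 0] by simp

lemma hom_minus: "x \<in> carrier L \<Longrightarrow> f (\<ominus>\<^bsub>L\<^esub> x) = \<ominus>\<^bsub>N\<^esub> f x"
  using hom_smult[of x "- 1"] by (simp add: dom.smult_minus_1 cod.smult_minus_1)

lemma hom_finsum:
  assumes "finite S" "g \<in> S \<rightarrow> carrier L"
  shows "f (\<Oplus>\<^bsub>L\<^esub>b\<in>S. g b) = (\<Oplus>\<^bsub>N\<^esub>b\<in>S. f (g b))"
  using assms
proof (induction S rule: finite_induct)
  case (insert b S)
  then have "g b \<in> carrier L" "g \<in> S \<rightarrow> carrier L" "(\<lambda>b. f (g b)) \<in> S \<rightarrow> carrier N"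
    by (auto simp: Pi_iff intro!: hom_closed)
  with insert show ?case by (simp add: hom_add)
qed (simp add: hom_zero)

lemma hom_span:
  assumes S: "S \<subseteq> carrier L"
  shows "f ` lin_span L S = lin_span N (f ` S)"
proof
  have fS: "f ` S \<subseteq> carrier N" using S by auto
  note ND = cod.subspaceD[OF cod.span_subspace[OF fS]]
  show "f ` lin_span L S \<subseteq> lin_span N (f ` S)"
  proof
    fix y assume "y \<in> f ` lin_span L S"
    then obtain x where x: "x \<in> lin_span L S" and y: "y = f x" by auto
    from x S have "f x \<in> lin_span N (f ` S)"
      by (induction rule: dom.span_induct)
        (auto simp: hom_zero hom_add hom_smult intro: cod.span_base ND(2,3,4))
    then show "y \<in> lin_span N (f ` S)" using y by simp
  qed
  note LD = dom.subspaceD[OF dom.span_subspace[OF S]]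
  show "lin_span N (f ` S) \<subseteq> f ` lin_span L S"
  proof (rule cod.span_minimal)
    show "f ` S \<subseteq> f ` lin_span L S" using dom.span_superset by auto
    show "lin_subspace N (f ` lin_span L S)"
    proof (rule cod.subspaceI)
      show "\<zero>\<^bsub>N\<^esub> \<in> f ` lin_span L S" using LD(2) hom_zero by (metis imageI)
      show "x \<oplus>\<^bsub>N\<^esub> y \<in> f ` lin_span L S" if xy: "x \<in> f ` lin_span L S" "y \<in> f ` lin_span L S" for x y
      proof -
        obtain u v where "u \<in> lin_span L S" "v \<in> lin_span L S" "x = f u" "y = f v" using xy by auto
        then show ?thesis using LD(3,6) hom_add by (metis imageI)
      qed
      show "a \<odot>\<^bsub>N\<^esub> x \<in> f ` lin_span L S" if x: "x \<in> f ` lin_span L S" for a x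
      proof -
        obtain u where "u \<in> lin_span L S" "x = f u" using x by auto
        then show ?thesis using LD(4,6) hom_smult by (metis imageI)
      qed
    qed (use LD(6) in auto)
  qed
qed

text \<open>Both sides are bilinear, so compatibility with brackets has to be checked only on a
  spanning set.\<close>

lemma hom_bracketI:
  assumes S: "S \<subseteq> carrier L" "lin_span L S = carrier L"
    and gen: "\<And>s t. s \<in> S \<Longrightarrow> t \<in> S \<Longrightarrow> f \<lbrakk>s, t\<rbrakk>\<^bsub>L\<^esub> = \<lbrakk>f s, f t\<rbrakk>\<^bsub>N\<^esub>"
    and x: "x \<in> carrier L" and y: "y \<in> carrier L"
  shows "f \<lbrakk>x, y\<rbrakk>\<^bsub>L\<^esub> = \<lbrakk>f x, f y\<rbrakk>\<^bsub>N\<^esub>"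
proof -
  have gen_y: "f \<lbrakk>s, y\<rbrakk>\<^bsub>L\<^esub> = \<lbrakk>f s, f y\<rbrakk>\<^bsub>N\<^esub>" if s: "s \<in> S" for s
  proof -
    have "y \<in> lin_span L S" using y S by simp
    then show ?thesis using S(1)
    proof (induction rule: dom.span_induct)
      case (base t)
      then show ?case using s gen by simp
    qed (use s S in \<open>simp_all add: subset_iff hom_zero hom_add hom_smult dom.bracket_add_right
        cod.bracket_add_right dom.bracket_smult_right cod.bracket_smult_right\<close>)
  qed
  have "x \<in> lin_span L S" using x S by simp
  then show ?thesis using S(1)
  proof (induction rule: dom.span_induct)
    case (base s)
    then show ?case by (rule gen_y)
  qed (use y in \<open>simp_all add: hom_zero hom_add hom_smult dom.bracket_add_left
        cod.bracket_add_left dom.bracket_smult_left cod.bracket_smult_left\<close>)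
qed

end

locale lie_algebra_hom = lie_linear_map +
  assumes hom_bracket: "x \<in> carrier L \<Longrightarrow> y \<in> carrier L \<Longrightarrow> f \<lbrakk>x, y\<rbrakk>\<^bsub>L\<^esub> = \<lbrakk>f x, f y\<rbrakk>\<^bsub>N\<^esub>"
begin

lemma hom_rotations:
  assumes J: "rotations L I J"
  shows "rotations N I (\<lambda>i j. f (J i j))"
  unfolding rotations_def
proof (intro conjI ballI)
  fix i j assume i: "i \<in> I" "j \<in> I"
  then have c: "J i j \<in> carrier L" "J j i \<in> carrier L" "J i j = \<ominus>\<^bsub>L\<^esub> J j i"
    using J unfolding rotations_def by blast+
  then show "f (J i j) \<in> carrier N" by simp
  show "f (J i j) = \<ominus>\<^bsub>N\<^esub> f (J j i)" using c hom_minus[of "J j i"] by simp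
  fix k l assume k: "k \<in> I" "l \<in> I"
  have c: "J \<mu> \<nu> \<in> carrier L" if "\<mu> \<in> I" "\<nu> \<in> I" for \<mu> \<nu>
    using J that unfolding rotations_def by blast
  have "\<lbrakk>J i j, J k l\<rbrakk>\<^bsub>L\<^esub> = of_bool (j = k) \<odot>\<^bsub>L\<^esub> J i l \<ominus>\<^bsub>L\<^esub> of_bool (j = l) \<odot>\<^bsub>L\<^esub> J i k
      \<oplus>\<^bsub>L\<^esub> of_bool (i = l) \<odot>\<^bsub>L\<^esub> J j k \<ominus>\<^bsub>L\<^esub> of_bool (i = k) \<odot>\<^bsub>L\<^esub> J j l"
    using J i k unfolding rotations_def by blast
  then show "\<lbrakk>f (J i j), f (J k l)\<rbrakk>\<^bsub>N\<^esub> =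
      of_bool (j = k) \<odot>\<^bsub>N\<^esub> f (J i l) \<ominus>\<^bsub>N\<^esub> of_bool (j = l) \<odot>\<^bsub>N\<^esub> f (J i k)
      \<oplus>\<^bsub>N\<^esub> of_bool (i = l) \<odot>\<^bsub>N\<^esub> f (J j k) \<ominus>\<^bsub>N\<^esub> of_bool (i = k) \<odot>\<^bsub>N\<^esub> f (J j l)"
    using i k c by (simp add: hom_bracket[symmetric] hom_add hom_minus hom_smult a_minus_def del: of_bool_eq_iff)
qed

lemma hom_vector_module:
  assumes V: "vector_module L I J V"
    and J: "\<And>i j. i \<in> I \<Longrightarrow> j \<in> I \<Longrightarrow> J i j \<in> carrier L" and Vc: "\<And>i. i \<in> I \<Longrightarrow> V i \<in> carrier L"
  shows "vector_module N I (\<lambda>i j. f (J i j)) (\<lambda>i. f (V i))"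
  unfolding vector_module_def
proof (intro ballI)
  fix i j k assume i: "i \<in> I" "j \<in> I" "k \<in> I"
  then have "\<lbrakk>J i j, V k\<rbrakk>\<^bsub>L\<^esub> = \<ominus>\<^bsub>L\<^esub> (of_bool (i = k) \<odot>\<^bsub>L\<^esub> V j) \<oplus>\<^bsub>L\<^esub> of_bool (j = k) \<odot>\<^bsub>L\<^esub> V i"
    using V unfolding vector_module_def by blast
  then show "\<lbrakk>f (J i j), f (V k)\<rbrakk>\<^bsub>N\<^esub> =
      \<ominus>\<^bsub>N\<^esub> (of_bool (i = k) \<odot>\<^bsub>N\<^esub> f (V j)) \<oplus>\<^bsub>N\<^esub> of_bool (j = k) \<odot>\<^bsub>N\<^esub> f (V i)"
    using i J Vc by (simp add: hom_bracket[symmetric] hom_add hom_minus hom_smult)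
qed

lemma hom_scalar_module:
  assumes "scalar_module L I J S" "\<And>i j. i \<in> I \<Longrightarrow> j \<in> I \<Longrightarrow> J i j \<in> carrier L" "S \<in> carrier L"
  shows "scalar_module N I (\<lambda>i j. f (J i j)) (f S)"
  using assms by (simp add: scalar_module_def hom_bracket[symmetric] hom_zero)

end

text \<open>Every element of \<open>N\<close> is an image, so closure conditions and equations carry
  over from \<open>L\<close>; the one existential axiom, additive inverses, is met by the image of
  the inverse.\<close>

lemma (in lie_algebra) lie_algebra_surj_image:
  fixes N :: "'b lie_algebra"
  assumes carr: "carrier N = f ` carrier L" and zero: "f \<zero>\<^bsub>L\<^esub> = \<zero>\<^bsub>N\<^esub>"
    and add: "\<And>x y. x \<in> carrier L \<Longrightarrow> y \<in> carrier L \<Longrightarrow> f x \<oplus>\<^bsub>N\<^esub> f y = f (x \<oplus>\<^bsub>L\<^esub> y)"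
    and smult: "\<And>a x. x \<in> carrier L \<Longrightarrow> a \<odot>\<^bsub>N\<^esub> f x = f (a \<odot> x)"
    and bracket: "\<And>x y. x \<in> carrier L \<Longrightarrow> y \<in> carrier L \<Longrightarrow> \<lbrakk>f x, f y\<rbrakk>\<^bsub>N\<^esub> = f \<lbrakk>x, y\<rbrakk>"
  shows "lie_algebra N"
proof (intro lie_algebra.intro lie_algebra_axioms.intro moduleI abelian_groupI)
  show "cring real_ring" by (rule cring_from_type_algebra)
  show "\<exists>y\<in>carrier N. y \<oplus>\<^bsub>N\<^esub> x = \<zero>\<^bsub>N\<^esub>" if x: "x \<in> carrier N" for x
  proof -
    obtain u where u: "u \<in> carrier L" "x = f u" using x carr by auto
    then show ?thesis
      using add[of "\<ominus>\<^bsub>L\<^esub> u" u] zero carr by (intro bexI[of _ "f (\<ominus>\<^bsub>L\<^esub> u)"]) (auto simp: M.l_neg)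
  qed
  show "x \<oplus>\<^bsub>N\<^esub> y \<oplus>\<^bsub>N\<^esub> z = x \<oplus>\<^bsub>N\<^esub> (y \<oplus>\<^bsub>N\<^esub> z)"
    if "x \<in> carrier N" "y \<in> carrier N" "z \<in> carrier N" for x y z
    using that by (auto simp: carr add M.a_assoc)
  show "x \<oplus>\<^bsub>N\<^esub> y = y \<oplus>\<^bsub>N\<^esub> x" if "x \<in> carrier N" "y \<in> carrier N" for x y
    using that by (auto simp: carr add M.a_comm)
qed (auto simp: carr zero[symmetric] add smult bracket smult_add smult_add_scalar smult_smult
      bracket_add_left bracket_add_right bracket_smult_left bracket_smult_right bracket_self jacobi)

section \<open>Cosets of an ideal and the quotient algebra\<close>

locale lie_algebra_ideal = lie_algebra +
  fixes V :: "'a set"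
  assumes ideal: "lie_ideal L V"
begin

lemma V_subspace: "lin_subspace L V"
  using ideal by (simp add: lie_ideal_def)

lemma V_carrier: "v \<in> V \<Longrightarrow> v \<in> carrier L"
  using subspaceD[OF V_subspace] by auto

lemma bracket_V_right: "x \<in> carrier L \<Longrightarrow> v \<in> V \<Longrightarrow> \<lbrakk>x, v\<rbrakk> \<in> V"
  using ideal by (simp add: lie_ideal_def)

lemma bracket_V_left: "x \<in> carrier L \<Longrightarrow> v \<in> V \<Longrightarrow> \<lbrakk>v, x\<rbrakk> \<in> V"
  using bracket_V_right[of x v] bracket_swap[of v x] V_carrier subspaceD(5)[OF V_subspace] by simp

lemma abelian_subgroup: "abelian_subgroup V L"
proof (rule abelian_subgroupI3)
  show "additive_subgroup V L"
    using V_subspace by (auto intro: additive_subgroupI dest: submodule.axioms(1))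
qed (rule M.abelian_group_axioms)

abbreviation proj :: "'a \<Rightarrow> 'a set" where "proj x \<equiv> V +>\<^bsub>L\<^esub> x"
abbreviation Q :: "'a set lie_algebra" where "Q \<equiv> lie_quotient L V"

lemma coset_mem: "z \<in> proj x \<longleftrightarrow> (\<exists>v\<in>V. z = v \<oplus>\<^bsub>L\<^esub> x)"
  by (auto simp: a_r_coset_def')

lemma proj_self: "x \<in> carrier L \<Longrightarrow> x \<in> proj x"
  unfolding coset_mem using subspaceD(2)[OF V_subspace] by (intro bexI[of _ "\<zero>\<^bsub>L\<^esub>"]) auto

text \<open>Independence of the representative; this makes scalar multiplication and bracket of
  cosets well defined.\<close>

lemma proj_shift:
  assumes "v \<in> V" "x \<in> carrier L"
  shows "proj (v \<oplus>\<^bsub>L\<^esub> x) = proj x"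
proof (intro Set.set_eqI iffI)
  note VD = subspaceD[OF V_subspace]
  fix z
  show "z \<in> proj x" if "z \<in> proj (v \<oplus>\<^bsub>L\<^esub> x)"
  proof -
    obtain w where w: "w \<in> V" "z = w \<oplus>\<^bsub>L\<^esub> (v \<oplus>\<^bsub>L\<^esub> x)" using \<open>z \<in> proj (v \<oplus>\<^bsub>L\<^esub> x)\<close> by (auto simp: coset_mem)
    then have "z = (w \<oplus>\<^bsub>L\<^esub> v) \<oplus>\<^bsub>L\<^esub> x" using assms VD(6) by (simp add: M.a_assoc)
    then show ?thesis using w assms VD(3) by (auto simp: coset_mem)
  qed
  show "z \<in> proj (v \<oplus>\<^bsub>L\<^esub> x)" if "z \<in> proj x"
  proof -
    obtain w where w: "w \<in> V" "z = w \<oplus>\<^bsub>L\<^esub> x" using \<open>z \<in> proj x\<close> by (auto simp: coset_mem)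
    have "z = (w \<oplus>\<^bsub>L\<^esub> \<ominus>\<^bsub>L\<^esub> v) \<oplus>\<^bsub>L\<^esub> (v \<oplus>\<^bsub>L\<^esub> x)"
      using w assms VD(6) by (simp add: M.a_assoc M.r_neg1)
    moreover have "w \<oplus>\<^bsub>L\<^esub> \<ominus>\<^bsub>L\<^esub> v \<in> V" using w assms VD(3,5) by simp
    ultimately show ?thesis unfolding coset_mem by blast
  qed
qed

lemma proj_eq_V_iff:
  assumes "x \<in> carrier L"
  shows "proj x = V \<longleftrightarrow> x \<in> V"
proof
  show "x \<in> V" if "proj x = V" using proj_self[OF assms] that by simp
  have "proj \<zero>\<^bsub>L\<^esub> = V" using V_carrier by (auto simp: coset_mem)
  then show "proj x = V" if "x \<in> V" using proj_shift[OF that, of "\<zero>\<^bsub>L\<^esub>"] assms by simp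
qed

lemma quotient_simps:
  "carrier Q = proj ` carrier L" "\<zero>\<^bsub>Q\<^esub> = V"
  by (auto simp: lie_quotient_def A_RCOSETS_def')

lemma quotient_add:
  "x \<in> carrier L \<Longrightarrow> y \<in> carrier L \<Longrightarrow> proj x \<oplus>\<^bsub>Q\<^esub> proj y = proj (x \<oplus>\<^bsub>L\<^esub> y)"
  by (simp add: lie_quotient_def abelian_subgroup.a_rcos_sum[OF abelian_subgroup])

text \<open>The union in \<open>lie_quotient\<close> runs over all representatives. It collapses
  because all its members are the same coset and \<open>proj_self\<close> provides at least one
  representative.\<close>

lemma quotient_smult:
  assumes "x \<in> carrier L"
  shows "a \<odot>\<^bsub>Q\<^esub> proj x = proj (a \<odot> x)"
proof -
  have "proj (a \<odot> z) = proj (a \<odot> x)" if z: "z \<in> proj x" for z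
  proof -
    obtain v where "v \<in> V" "z = v \<oplus>\<^bsub>L\<^esub> x" using z by (auto simp: coset_mem)
    then show ?thesis
      using assms V_carrier subspaceD(4)[OF V_subspace] by (simp add: smult_add proj_shift)
  qed
  then have "(\<Union>z\<in>proj x. proj (a \<odot> z)) = proj (a \<odot> x)" using proj_self[OF assms] by blast
  then show ?thesis by (simp add: lie_quotient_def)
qed

lemma quotient_bracket:
  assumes "x \<in> carrier L" "y \<in> carrier L"
  shows "\<lbrakk>proj x, proj y\<rbrakk>\<^bsub>Q\<^esub> = proj \<lbrakk>x, y\<rbrakk>"
proof -
  have "proj \<lbrakk>z, w\<rbrakk> = proj \<lbrakk>x, y\<rbrakk>" if zw: "z \<in> proj x" "w \<in> proj y" for z w
  proof -
    obtain u v where uv: "u \<in> V" "v \<in> V" "z = u \<oplus>\<^bsub>L\<^esub> x" "w = v \<oplus>\<^bsub>L\<^esub> y"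
      using zw by (auto simp: coset_mem)
    have c: "u \<in> carrier L" "v \<in> carrier L" using uv V_carrier by auto
    \<comment> \<open>Changing both representatives adds two brackets that each have an entry in the
      ideal, so \<open>proj_shift\<close> absorbs them one after the other.\<close>
    have "\<lbrakk>z, w\<rbrakk> = \<lbrakk>u, w\<rbrakk> \<oplus>\<^bsub>L\<^esub> (\<lbrakk>x, v\<rbrakk> \<oplus>\<^bsub>L\<^esub> \<lbrakk>x, y\<rbrakk>)"
    proof -
      have "w \<in> carrier L" using uv(4) c assms by simp
      then have "\<lbrakk>z, w\<rbrakk> = \<lbrakk>u, w\<rbrakk> \<oplus>\<^bsub>L\<^esub> \<lbrakk>x, w\<rbrakk>" using uv(3) c assms by (simp add: bracket_add_left)
      also have "\<lbrakk>x, w\<rbrakk> = \<lbrakk>x, v\<rbrakk> \<oplus>\<^bsub>L\<^esub> \<lbrakk>x, y\<rbrakk>" using uv(4) c assms by (simp add: bracket_add_right)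
      finally show ?thesis .
    qed
    moreover have "\<lbrakk>u, w\<rbrakk> \<in> V" "\<lbrakk>x, v\<rbrakk> \<in> V"
      using uv c assms by (auto intro: bracket_V_left bracket_V_right)
    ultimately show ?thesis using assms c by (simp add: proj_shift)
  qed
  then have "(\<Union>z\<in>proj x. \<Union>w\<in>proj y. proj \<lbrakk>z, w\<rbrakk>) = proj \<lbrakk>x, y\<rbrakk>"
    using proj_self assms by blast
  then show ?thesis by (simp add: lie_quotient_def)
qed

lemma lie_algebra_quotient: "lie_algebra Q"
proof (rule lie_algebra_surj_image[where f = proj])
  show "proj \<zero>\<^bsub>L\<^esub> = \<zero>\<^bsub>Q\<^esub>"
    using subspaceD(2)[OF V_subspace] by (simp add: quotient_simps proj_eq_V_iff)
qed (simp_all add: quotient_simps quotient_add quotient_smult quotient_bracket)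

lemma proj_hom: "lie_algebra_hom L Q proj"
  by (intro lie_algebra_hom.intro lie_algebra_hom_axioms.intro lie_linear_map.intro lie_linear_map_axioms.intro lie_algebra_quotient lie_algebra_axioms)
    (auto simp: quotient_simps quotient_add quotient_smult quotient_bracket)

end

text \<open>Generators indexed by \<open>S\<close> project to zero, so the others span. A relation
  among their classes lifts to a vector in the span of \<open>S\<close>, whose coordinates outside
  \<open>S\<close> vanish; these coordinates are the coefficients of the relation.\<close>

lemma (in lie_algebra_basis) is_basis_quotient:
  assumes S: "S \<subseteq> B" and I: "lie_ideal L (lin_span L (E ` S))"
  shows "is_basis (lie_quotient L (lin_span L (E ` S))) (B - S) (\<lambda>b. lin_span L (E ` S) +>\<^bsub>L\<^esub> E b)"
proof -
  define V where "V = lin_span L (E ` S)"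
  interpret V: lie_algebra_ideal L V
    by unfold_locales (use I in \<open>simp add: V_def\<close>)
  interpret pr: lie_algebra_hom L V.Q V.proj by (rule V.proj_hom)
  have "V.proj ` E ` B \<subseteq> lin_span V.Q (V.proj ` E ` (B - S))"
  proof
    fix A assume "A \<in> V.proj ` E ` B"
    then obtain b where b: "b \<in> B" "A = V.proj (E b)" by auto
    show "A \<in> lin_span V.Q (V.proj ` E ` (B - S))"
    proof (cases "b \<in> S")
      case True
      then have "E b \<in> V" unfolding V_def by (auto intro: span_base)
      then have "A = \<zero>\<^bsub>V.Q\<^esub>" using b E_carrier by (simp add: V.proj_eq_V_iff V.quotient_simps)
      moreover have "V.proj ` E ` (B - S) \<subseteq> carrier V.Q" using E_carrier by auto
      ultimately show ?thesis using pr.cod.subspaceD(2)[OF pr.cod.span_subspace] by simp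
    next
      case False
      then show ?thesis using b by (auto intro: pr.cod.span_base)
    qed
  qed
  then have "lin_span V.Q (V.proj ` E ` B) \<subseteq> lin_span V.Q (V.proj ` E ` (B - S))"
    by (rule pr.cod.span_le_span) (use E_carrier in auto)
  moreover have "lin_span V.Q (V.proj ` E ` B) = carrier V.Q"
    using pr.hom_span[OF E_image_carrier[OF order_refl]] by (simp add: span_E V.quotient_simps)
  moreover have "lin_span V.Q (V.proj ` E ` (B - S)) \<subseteq> carrier V.Q"
    by (rule pr.cod.subspaceD(1)[OF pr.cod.span_subspace]) (use E_carrier in auto)
  ultimately have span: "lin_span V.Q ((\<lambda>b. V.proj (E b)) ` (B - S)) = carrier V.Q"
    by (simp add: image_image)
  have indep: "c b = 0" if sum: "(\<Oplus>\<^bsub>V.Q\<^esub>b\<in>B - S. c b \<odot>\<^bsub>V.Q\<^esub> V.proj (E b)) = \<zero>\<^bsub>V.Q\<^esub>" and b: "b \<in> B - S" for c b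
  proof -
    define x where "x = (\<Oplus>\<^bsub>L\<^esub>b\<in>B - S. c b \<odot> E b)"
    have fam: "(\<lambda>b. c b \<odot> E b) \<in> B - S \<rightarrow> carrier L" using E_carrier by auto
    have x: "x \<in> carrier L" unfolding x_def by (rule M.finsum_closed[OF fam])
    have "V.proj x = (\<Oplus>\<^bsub>V.Q\<^esub>b\<in>B - S. V.proj (c b \<odot> E b))"
      unfolding x_def by (rule pr.hom_finsum[OF _ fam]) (use finite_B in simp)
    also have "\<dots> = (\<Oplus>\<^bsub>V.Q\<^esub>b\<in>B - S. c b \<odot>\<^bsub>V.Q\<^esub> V.proj (E b))"
      by (rule pr.cod.M.finsum_cong') (use E_carrier in \<open>auto simp: pr.hom_smult\<close>)
    finally have "V.proj x = V" using sum by (simp add: V.quotient_simps)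
    then have "x \<in> lin_span L (E ` S)" using V.proj_eq_V_iff[OF x] by (simp add: V_def)
    then have "coord x b = 0" using S b by (auto intro: coord_span_zero)
    \<comment> \<open>Padding the coefficients by zero on \<open>S\<close> turns the sum over
      \<open>B - S\<close> into a combination over the whole basis, from which coordinates can be
      read off.\<close>
    moreover have "x = lincomb (\<lambda>b. if b \<in> S then 0 else c b)"
    proof -
      have "lincomb (\<lambda>b. if b \<in> S then 0 else c b) = (\<Oplus>\<^bsub>L\<^esub>b\<in>B. if b \<in> S then \<zero>\<^bsub>L\<^esub> else c b \<odot> E b)"
        unfolding lincomb_def by (rule M.finsum_cong') (use E_carrier in auto)
      also have "\<dots> = x"
        unfolding x_def
        by (rule M.add.finprod_mono_neutral_cong_right) (use finite_B E_carrier in auto)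
      finally show ?thesis by simp
    qed
    then have "coord x b = c b" using coord_eqI[of x _ b] b by auto
    ultimately show ?thesis by simp
  qed
  show ?thesis
    using finite_B E_carrier span indep unfolding V_def[symmetric] is_basis_def by auto
qed

text \<open>Both the map and its inverse copy coordinates from one basis to the other. Arbitrary
  values of \<open>coord\<close> off \<open>B\<close> do no harm, since \<open>lincomb\<close>
  evaluates its argument only on \<open>B\<close>.\<close>

lemma (in lie_algebra_basis) exists_linear_bijection:
  fixes N :: "'b lie_algebra"
  assumes F: "lie_algebra_basis N B F"
  obtains f where "bij_betw f (carrier L) (carrier N)"
    "\<And>x y. x \<in> carrier L \<Longrightarrow> y \<in> carrier L \<Longrightarrow> f (x \<oplus>\<^bsub>L\<^esub> y) = f x \<oplus>\<^bsub>N\<^esub> f y"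
    "\<And>a x. x \<in> carrier L \<Longrightarrow> f (a \<odot> x) = a \<odot>\<^bsub>N\<^esub> f x"
    "\<And>b. b \<in> B \<Longrightarrow> f (E b) = F b"
proof -
  interpret F: lie_algebra_basis N B F by (rule F)
  define f where "f x = F.lincomb (coord x)" for x
  define g where "g y = lincomb (F.coord y)" for y
  have gf: "g (f x) = x" if "x \<in> carrier L" for x
  proof -
    have "g (f x) = lincomb (coord x)"
      unfolding g_def by (rule lincomb_cong) (simp add: f_def F.coord_eqI)
    then show ?thesis using that by (simp add: lincomb_coord)
  qed
  have fg: "f (g y) = y" if "y \<in> carrier N" for y
  proof -
    have "f (g y) = F.lincomb (F.coord y)"
      unfolding f_def by (rule F.lincomb_cong) (simp add: g_def coord_eqI)
    then show ?thesis using that by (simp add: F.lincomb_coord)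
  qed
  have "bij_betw f (carrier L) (carrier N)"
  proof (rule bij_betwI[where g = g])
    show "f \<in> carrier L \<rightarrow> carrier N" by (simp add: f_def F.lincomb_carrier)
    show "g \<in> carrier N \<rightarrow> carrier L" by (simp add: g_def lincomb_carrier)
  qed (simp_all add: gf fg)
  moreover have "f (x \<oplus>\<^bsub>L\<^esub> y) = f x \<oplus>\<^bsub>N\<^esub> f y" if "x \<in> carrier L" "y \<in> carrier L" for x y
    unfolding f_def F.lincomb_add[symmetric] by (rule F.lincomb_cong) (simp add: coord_add that)
  moreover have "f (a \<odot> x) = a \<odot>\<^bsub>N\<^esub> f x" if "x \<in> carrier L" for a x
    unfolding f_def F.lincomb_smult[symmetric] by (rule F.lincomb_cong) (simp add: coord_smult that)
  moreover have "f (E b) = F b" if "b \<in> B" for b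
    unfolding f_def F.lincomb_of_bool[OF that, symmetric] by (rule F.lincomb_cong) (simp add: coord_E that)
  ultimately show thesis by (rule that)
qed

section \<open>Consequences of the rotation relations\<close>

context lie_algebra
begin

text \<open>Holds because 2 is invertible; it turns the antisymmetry of \<open>J\<close> into the
  vanishing of its diagonal.\<close>

lemma eq_minus_self_zero:
  assumes "x \<in> carrier L" "x = \<ominus>\<^bsub>L\<^esub> x"
  shows "x = \<zero>\<^bsub>L\<^esub>"
proof -
  have "2 \<odot> x = x \<oplus>\<^bsub>L\<^esub> x" using assms(1) smult_add_scalar[of x 1 1] by simp
  also have "\<dots> = \<zero>\<^bsub>L\<^esub>" using assms M.r_neg[of x] by simp
  finally have "(1 / 2) \<odot> (2 \<odot> x) = \<zero>\<^bsub>L\<^esub>" by simp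
  then show ?thesis using assms(1) by (simp add: smult_smult)
qed

lemma rotations_carrier: "rotations L I J \<Longrightarrow> i \<in> I \<Longrightarrow> j \<in> I \<Longrightarrow> J i j \<in> carrier L"
  unfolding rotations_def by blast

lemma rotations_swap: "rotations L I J \<Longrightarrow> i \<in> I \<Longrightarrow> j \<in> I \<Longrightarrow> J i j = \<ominus>\<^bsub>L\<^esub> J j i"
  unfolding rotations_def by blast

lemma rotations_diag: "rotations L I J \<Longrightarrow> i \<in> I \<Longrightarrow> J i i = \<zero>\<^bsub>L\<^esub>"
  by (intro eq_minus_self_zero rotations_carrier rotations_swap)

lemma rotations_bracket:
  "rotations L I J \<Longrightarrow> i \<in> I \<Longrightarrow> j \<in> I \<Longrightarrow> k \<in> I \<Longrightarrow> l \<in> I \<Longrightarrow>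
    \<lbrakk>J i j, J k l\<rbrakk> = of_bool (j = k) \<odot> J i l \<ominus>\<^bsub>L\<^esub> of_bool (j = l) \<odot> J i k
      \<oplus>\<^bsub>L\<^esub> of_bool (i = l) \<odot> J j k \<ominus>\<^bsub>L\<^esub> of_bool (i = k) \<odot> J j l"
  unfolding rotations_def by blast

text \<open>Basis labels exist only for \<open>i < j\<close>; the diagonal is zero and the other
  half differs by a sign.\<close>

lemma rotations_in_subspace:
  assumes "lin_subspace L V" "rotations L I J" "\<And>i j. i \<in> I \<Longrightarrow> j \<in> I \<Longrightarrow> i < j \<Longrightarrow> J i j \<in> V"
    and i: "i \<in> I" "j \<in> I"
  shows "J i j \<in> V"
proof -
  consider "i < j" | "i = j" | "j < i" by linarith
  then show ?thesis
  proof cases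
    case 3
    then have "\<ominus>\<^bsub>L\<^esub> J j i \<in> V" using assms subspaceD(5)[OF assms(1)] by blast
    then show ?thesis using rotations_swap[OF assms(2) i] by simp
  qed (use assms rotations_diag subspaceD(2)[OF assms(1)] in auto)
qed

lemma vector_module_bracket:
  "vector_module L I J V \<Longrightarrow> i \<in> I \<Longrightarrow> j \<in> I \<Longrightarrow> k \<in> I \<Longrightarrow>
    \<lbrakk>J i j, V k\<rbrakk> = \<ominus>\<^bsub>L\<^esub> (of_bool (i = k) \<odot> V j) \<oplus>\<^bsub>L\<^esub> of_bool (j = k) \<odot> V i"
  unfolding vector_module_def by blast

lemma rotations_bracket_in_subspace:
  assumes V: "lin_subspace L V" and J: "rotations L I J"
    and JV: "\<And>i j. i \<in> I \<Longrightarrow> j \<in> I \<Longrightarrow> J i j \<in> V" and i: "i \<in> I" "j \<in> I" "k \<in> I" "l \<in> I"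
  shows "\<lbrakk>J i j, J k l\<rbrakk> \<in> V"
  unfolding rotations_bracket[OF J i] a_minus_def
  by (intro subspaceD(3)[OF V] subspaceD(4)[OF V] subspaceD(5)[OF V] JV i)

lemma vector_module_bracket_in_subspace:
  assumes V: "lin_subspace L V" and J: "vector_module L I J U"
    and UV: "\<And>i. i \<in> I \<Longrightarrow> U i \<in> V" and i: "i \<in> I" "j \<in> I" "k \<in> I"
  shows "\<lbrakk>J i j, U k\<rbrakk> \<in> V"
  unfolding vector_module_bracket[OF J i]
  by (intro subspaceD(3)[OF V] subspaceD(4)[OF V] subspaceD(5)[OF V] UV i)

text \<open>The disjunction in \<open>gen\<close> allows each unordered pair of generators to be
  treated in whichever order the relations provide.\<close>

lemma lie_subalgebra_spanI:
  assumes S: "S \<subseteq> carrier L"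
    and gen: "\<And>s t. s \<in> S \<Longrightarrow> t \<in> S \<Longrightarrow> \<lbrakk>s, t\<rbrakk> \<in> lin_span L S \<or> \<lbrakk>t, s\<rbrakk> \<in> lin_span L S"
  shows "lie_subalgebra L (lin_span L S)"
proof -
  note D = subspaceD[OF span_subspace[OF S]]
  have "\<lbrakk>s, t\<rbrakk> \<in> lin_span L S" if st: "s \<in> S" "t \<in> S" for s t
    using gen[OF st] D(5)[of "\<lbrakk>t, s\<rbrakk>"] bracket_swap[of s t] st S by (auto simp: subset_iff)
  then show ?thesis
    unfolding lie_subalgebra_def
    using bracket_span_in_subspace[OF span_subspace[OF S] S S] span_subspace[OF S] by blast
qed

end

text \<open>A common vector has zero coordinates outside \<open>S\<close> and outside
  \<open>T\<close>, hence everywhere by disjointness. The sum is everything because each generator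
  lies in one of the two spans.\<close>

lemma (in lie_algebra_basis) splitting_span:
  assumes "S \<inter> T = {}" "S \<union> T = B"
  shows "splitting L (lin_span L (E ` S)) (lin_span L (E ` T))"
proof -
  have c: "E ` S \<subseteq> carrier L" "E ` T \<subseteq> carrier L" using assms E_image_carrier by auto
  note SD = subspaceD[OF span_subspace[OF c(1)]] and TD = subspaceD[OF span_subspace[OF c(2)]]
  have trivial: "x = \<zero>\<^bsub>L\<^esub>" if x: "x \<in> lin_span L (E ` S)" "x \<in> lin_span L (E ` T)" for x
  proof (rule zero_if_coord_zero)
    show "x \<in> carrier L" using x SD by auto
    show "coord x b = 0" if "b \<in> B" for b
      using that coord_span_zero[OF x(1), of b] coord_span_zero[OF x(2), of b] assms by blast
  qed
  have sum: "\<exists>u\<in>lin_span L (E ` S). \<exists>v\<in>lin_span L (E ` T). x = u \<oplus>\<^bsub>L\<^esub> v" if x: "x \<in> carrier L" for x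
  proof -
    have "x \<in> lin_span L (E ` B)" using x by (simp add: span_E)
    then show ?thesis using E_image_carrier[OF order_refl]
    proof (induction rule: span_induct)
      case (base s)
      then obtain b where b: "s = E b" "b \<in> S \<or> b \<in> T" using assms by auto
      then show ?case
      proof (elim disjE)
        assume "b \<in> S"
        then have s: "s \<in> lin_span L (E ` S)" using b by (auto intro: span_base)
        then have "s = s \<oplus>\<^bsub>L\<^esub> \<zero>\<^bsub>L\<^esub>" using SD(6) by simp
        with s show ?thesis using TD(2) by blast
      next
        assume "b \<in> T"
        then have s: "s \<in> lin_span L (E ` T)" using b by (auto intro: span_base)
        then have "s = \<zero>\<^bsub>L\<^esub> \<oplus>\<^bsub>L\<^esub> s" using TD(6) by simp
        with s show ?thesis using SD(2) by blast
      qed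
    next
      case zero
      then show ?case using SD(2) TD(2) by (intro bexI[of _ "\<zero>\<^bsub>L\<^esub>"]) auto
    next
      case (add x y)
      then obtain u v s t where "u \<in> lin_span L (E ` S)" "v \<in> lin_span L (E ` T)" "x = u \<oplus>\<^bsub>L\<^esub> v"
        "s \<in> lin_span L (E ` S)" "t \<in> lin_span L (E ` T)" "y = s \<oplus>\<^bsub>L\<^esub> t" by blast
      then show ?case
        using SD(3,6) TD(3,6)
        by (intro bexI[of _ "u \<oplus>\<^bsub>L\<^esub> s"] bexI[of _ "v \<oplus>\<^bsub>L\<^esub> t"]) (simp_all add: M.a_ac)
    next
      case (smult a x)
      then obtain u v where "u \<in> lin_span L (E ` S)" "v \<in> lin_span L (E ` T)" "x = u \<oplus>\<^bsub>L\<^esub> v" by blast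
      then show ?case
        using SD(4,6) TD(4,6)
        by (intro bexI[of _ "a \<odot> u"] bexI[of _ "a \<odot> v"]) (simp_all add: smult_add)
    qed
  qed
  have "lin_span L (E ` S) \<inter> lin_span L (E ` T) = {\<zero>\<^bsub>L\<^esub>}"
  proof
    show "lin_span L (E ` S) \<inter> lin_span L (E ` T) \<subseteq> {\<zero>\<^bsub>L\<^esub>}"
      using trivial by fast
  qed (use SD(2) TD(2) in simp)
  moreover have "lin_span L (E ` S) <+>\<^bsub>L\<^esub> lin_span L (E ` T) = carrier L"
  proof
    show "lin_span L (E ` S) <+>\<^bsub>L\<^esub> lin_span L (E ` T) \<subseteq> carrier L"
      by (rule M.setadd_subset_G[OF SD(1) TD(1)])
    show "carrier L \<subseteq> lin_span L (E ` S) <+>\<^bsub>L\<^esub> lin_span L (E ` T)"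
      using sum by (auto simp: set_add_def')
  qed
  ultimately show ?thesis
    using span_subspace[OF c(1)] span_subspace[OF c(2)] by (simp add: splitting_def)
qed

section \<open>Rotation modules under contraction\<close>

context lie_splitting
begin

lemma contraction_rotations:
  assumes J: "rotations L I J" and Jk: "\<And>i j. i \<in> I \<Longrightarrow> j \<in> I \<Longrightarrow> J i j \<in> kk"
  shows "rotations G I J"
  unfolding rotations_def
proof (intro conjI ballI)
  fix i j assume i: "i \<in> I" "j \<in> I"
  then show "J i j \<in> carrier G" using rotations_carrier[OF J] by simp
  show "J i j = \<ominus>\<^bsub>G\<^esub> J j i" using rotations_swap[OF J i] by simp
  fix k l assume k: "k \<in> I" "l \<in> I"
  show "\<lbrakk>J i j, J k l\<rbrakk>\<^bsub>G\<^esub> = of_bool (j = k) \<odot>\<^bsub>G\<^esub> J i l \<ominus>\<^bsub>G\<^esub> of_bool (j = l) \<odot>\<^bsub>G\<^esub> J i k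
      \<oplus>\<^bsub>G\<^esub> of_bool (i = l) \<odot>\<^bsub>G\<^esub> J j k \<ominus>\<^bsub>G\<^esub> of_bool (i = k) \<odot>\<^bsub>G\<^esub> J j l"
    using rotations_bracket[OF J i k] Jk i k by (simp only: contraction_bracket_kk contraction_simps contraction_minus2)
qed

text \<open>On \<open>kk\<close> the bracket is unchanged. If the vectors lie in \<open>ii\<close>,
  so do their brackets with rotations, being combinations of the same vectors, and the projection
  \<open>pi\<close> acts as the identity.\<close>

lemma contraction_vector_module:
  assumes V: "vector_module L I J V" and Jk: "\<And>i j. i \<in> I \<Longrightarrow> j \<in> I \<Longrightarrow> J i j \<in> kk"
    and "(\<forall>i\<in>I. V i \<in> kk) \<or> (\<forall>i\<in>I. V i \<in> ii)"
  shows "vector_module G I J V"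
  using assms(3)
proof
  assume "\<forall>i\<in>I. V i \<in> kk"
  then show ?thesis using V Jk by (simp add: vector_module_def contraction_bracket_kk)
next
  assume Vi: "\<forall>i\<in>I. V i \<in> ii"
  show ?thesis
    unfolding vector_module_def
  proof (intro ballI)
    fix i j k assume i: "i \<in> I" "j \<in> I" "k \<in> I"
    have "\<lbrakk>J i j, V k\<rbrakk> \<in> ii"
      using vector_module_bracket_in_subspace[OF ii V _ i] Vi by blast
    then have "\<lbrakk>J i j, V k\<rbrakk>\<^bsub>G\<^esub> = \<lbrakk>J i j, V k\<rbrakk>"
      using i Jk Vi by (simp add: contraction_bracket_ki)
    then show "\<lbrakk>J i j, V k\<rbrakk>\<^bsub>G\<^esub> = \<ominus>\<^bsub>G\<^esub> (of_bool (i = k) \<odot>\<^bsub>G\<^esub> V j) \<oplus>\<^bsub>G\<^esub> of_bool (j = k) \<odot>\<^bsub>G\<^esub> V i"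
      using vector_module_bracket[OF V i] by simp
  qed
qed

lemma contraction_scalar_module:
  assumes V: "scalar_module L I J S" and Jk: "\<And>i j. i \<in> I \<Longrightarrow> j \<in> I \<Longrightarrow> J i j \<in> kk"
    and "S \<in> kk \<or> S \<in> ii"
  shows "scalar_module G I J S"
  using assms subspaceD(2)[OF kk]
  by (auto simp: scalar_module_def contraction_bracket_kk contraction_bracket_ki)

end

section \<open>Galilean Klein pairs\<close>

lemma kin_labels_h:
  "kin_labels I - ({kH} \<union> kP ` I) = kK ` I \<union> {kJ i j | i j. i \<in> I \<and> j \<in> I \<and> i < j}"
  by (auto simp: kin_labels_def)

locale galilean = lie_algebra L for L :: "'a lie_algebra" (structure) +
  fixes \<epsilon> \<omega> :: real and I :: "nat set" and hh :: "'a set" and E :: "kin_label \<Rightarrow> 'a"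
  assumes galilean: "galilean_klein_pair \<epsilon> \<omega> L I hh E"
begin

lemma kinematical: "kinematical_klein_pair L I hh E"
  using galilean by (simp add: galilean_klein_pair_def)

lemma basis: "is_basis L (kin_labels I) E"
  and hh_span: "hh = lin_span L (E ` (kin_labels I - ({kH} \<union> kP ` I)))"
  and J_rotations: "rotations L I (\<lambda>\<mu> \<nu>. E (kJ \<mu> \<nu>))"
  and P_vector: "vector_module L I (\<lambda>\<mu> \<nu>. E (kJ \<mu> \<nu>)) (\<lambda>\<mu>. E (kP \<mu>))"
  and K_vector: "vector_module L I (\<lambda>\<mu> \<nu>. E (kJ \<mu> \<nu>)) (\<lambda>\<mu>. E (kK \<mu>))"
  and H_scalar: "scalar_module L I (\<lambda>\<mu> \<nu>. E (kJ \<mu> \<nu>)) (E kH)"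
  and hh_subalgebra: "lie_subalgebra L hh"
  using kinematical unfolding kinematical_klein_pair_def klein_pair_def by blast+

sublocale lie_algebra_basis L "kin_labels I" E
  by unfold_locales (rule basis)

lemma kin_labels_simps [simp]:
  "kH \<in> kin_labels I" "kP i \<in> kin_labels I \<longleftrightarrow> i \<in> I" "kK i \<in> kin_labels I \<longleftrightarrow> i \<in> I"
  "kJ i j \<in> kin_labels I \<longleftrightarrow> i \<in> I \<and> j \<in> I \<and> i < j"
  by (auto simp: kin_labels_def)

lemma generators_carrier [simp]:
  "E kH \<in> carrier L" "i \<in> I \<Longrightarrow> E (kP i) \<in> carrier L" "i \<in> I \<Longrightarrow> E (kK i) \<in> carrier L"
  "i \<in> I \<Longrightarrow> j \<in> I \<Longrightarrow> E (kJ i j) \<in> carrier L"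
  using E_carrier rotations_carrier[OF J_rotations] by simp_all

lemma brackets:
  assumes "i \<in> I"
  shows "\<lbrakk>E (kK i), E kH\<rbrakk> = E (kP i)"
    and "\<lbrakk>E kH, E (kP i)\<rbrakk> = \<epsilon> \<odot> E (kK i) \<oplus>\<^bsub>L\<^esub> \<omega> \<odot> E (kP i)"
    and "j \<in> I \<Longrightarrow> \<lbrakk>E (kK i), E (kK j)\<rbrakk> = \<zero>\<^bsub>L\<^esub>"
    and "j \<in> I \<Longrightarrow> \<lbrakk>E (kK i), E (kP j)\<rbrakk> = \<zero>\<^bsub>L\<^esub>"
    and "j \<in> I \<Longrightarrow> \<lbrakk>E (kP i), E (kP j)\<rbrakk> = \<zero>\<^bsub>L\<^esub>"
    and "j \<in> I \<Longrightarrow> \<lbrakk>E (kP i), E (kK j)\<rbrakk> = \<zero>\<^bsub>L\<^esub>"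
    and "j \<in> I \<Longrightarrow> \<lbrakk>E (kJ i j), E kH\<rbrakk> = \<zero>\<^bsub>L\<^esub>"
proof -
  show "\<lbrakk>E (kP i), E (kK j)\<rbrakk> = \<zero>\<^bsub>L\<^esub>" if "j \<in> I"
    using bracket_swap[of "E (kP i)" "E (kK j)"] assms that galilean
    by (simp add: galilean_klein_pair_def)
qed (use assms galilean H_scalar in \<open>simp_all add: galilean_klein_pair_def scalar_module_def\<close>)

lemmas J_bracket_P = vector_module_bracket[OF P_vector]
  and J_bracket_K = vector_module_bracket[OF K_vector]
  and J_bracket_J = rotations_bracket[OF J_rotations]

lemma effective: "effective_klein_pair L hh"
  unfolding hh_span
proof (rule effective_klein_pairI)
  show "lie_subalgebra L (lin_span L (E ` (kin_labels I - ({kH} \<union> kP ` I))))"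
    using hh_subalgebra by (simp add: hh_span)
  fix s assume s: "s \<in> kin_labels I - ({kH} \<union> kP ` I)"
  then consider (K) i where "s = kK i" "i \<in> I" | (J) i j where "s = kJ i j" "i \<in> I" "j \<in> I" "i < j"
    unfolding kin_labels_h by blast
  then show "\<exists>y\<in>carrier L. \<exists>t\<in>kin_labels I - (kin_labels I - ({kH} \<union> kP ` I)).
      \<forall>s'\<in>kin_labels I - ({kH} \<union> kP ` I). coord \<lbrakk>E s', y\<rbrakk> t = of_bool (s' = s)"
  proof cases
    case K
    then show ?thesis
      unfolding kin_labels_h
      \<comment> \<open>Bracketing with \<open>H\<close> kills the rotations and sends
        \<open>K_i\<close> to \<open>P_i\<close>.\<close>
      by (intro bexI[of _ "E kH"] bexI[of _ "kP i"]) (auto simp: brackets coord_E coord_zero)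
  next
    case J
    then show ?thesis
      unfolding kin_labels_h
      \<comment> \<open>The \<open>P_i\<close>-coordinate of \<open>[J_kl, P_j]\<close> is 1 for
        \<open>(k, l) = (i, j)\<close> and -1 for \<open>(k, l) = (j, i)\<close>. The latter is
        excluded by \<open>k < l\<close> and \<open>i < j\<close>, so only \<open>J_ij\<close> is
        seen.\<close>
      by (intro bexI[of _ "E (kP j)"] bexI[of _ "kP i"])
        (auto simp: brackets J_bracket_P of_bool_def coord_E coord_zero coord_add coord_minus coord_smult split: if_splits)
  qed
qed auto

end

text \<open>The relations express each bracket of generators through generators with coefficients
  depending only on \<epsilon>, \<omega> and the indices. The linear map matching the two bases
  therefore respects brackets.\<close>

lemma galilean_isomorphic:
  fixes L :: "'a lie_algebra" and N :: "'b lie_algebra"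
  assumes L: "galilean_klein_pair \<epsilon> \<omega> L I hh E" and N: "galilean_klein_pair \<epsilon> \<omega> N I hN Z"
  shows "klein_isomorphic L hh N hN"
proof -
  have "lie_algebra L" "lie_algebra N"
    using L N by (auto simp: galilean_klein_pair_def kinematical_klein_pair_def klein_pair_def)
  then interpret L: galilean L \<epsilon> \<omega> I hh E + N: galilean N \<epsilon> \<omega> I hN Z
    using L N by (auto intro!: galilean.intro galilean_axioms.intro)
  obtain f where bij: "bij_betw f (carrier L) (carrier N)"
    and add: "\<And>x y. x \<in> carrier L \<Longrightarrow> y \<in> carrier L \<Longrightarrow> f (x \<oplus>\<^bsub>L\<^esub> y) = f x \<oplus>\<^bsub>N\<^esub> f y"
    and smult: "\<And>a x. x \<in> carrier L \<Longrightarrow> f (a \<odot>\<^bsub>L\<^esub> x) = a \<odot>\<^bsub>N\<^esub> f x"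
    and fE: "\<And>b. b \<in> kin_labels I \<Longrightarrow> f (E b) = Z b"
    using L.exists_linear_bijection[OF N.lie_algebra_basis_axioms] by blast
  interpret f: lie_linear_map L N f
    by unfold_locales (use bij add smult in \<open>auto simp: bij_betw_def\<close>)
  \<comment> \<open>The map is prescribed only on labels with \<open>i < j\<close>, but the
    relations mention \<open>J\<close> at all pairs of indices.\<close>
  have fJ: "f (E (kJ i j)) = Z (kJ i j)" if i: "i \<in> I" "j \<in> I" for i j
  proof -
    consider "i < j" | "i = j" | "j < i" by linarith
    then show ?thesis
    proof cases
      case 2
      then show ?thesis
        using i L.rotations_diag[OF L.J_rotations] N.rotations_diag[OF N.J_rotations] f.hom_zero by simp
    next
      case 3
      then have "f (E (kJ j i)) = Z (kJ j i)" using i fE by simp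
      then show ?thesis
        using i L.rotations_swap[OF L.J_rotations i] N.rotations_swap[OF N.J_rotations i] f.hom_minus by simp
    qed (use i fE in simp)
  qed
  let ?good = "\<lambda>x y. f \<lbrakk>x, y\<rbrakk>\<^bsub>L\<^esub> = \<lbrakk>f x, f y\<rbrakk>\<^bsub>N\<^esub>"
  have sym: "?good y x" if "?good x y" "x \<in> carrier L" "y \<in> carrier L" for x y
    using that L.bracket_swap[of y x] N.bracket_swap[of "f y" "f x"] f.hom_minus by simp
  note simps = fE fJ f.hom_zero f.hom_add f.hom_smult f.hom_minus a_minus_def
    L.brackets N.brackets L.J_bracket_P N.J_bracket_P L.J_bracket_K N.J_bracket_K
  have "f \<lbrakk>x, y\<rbrakk>\<^bsub>L\<^esub> = \<lbrakk>f x, f y\<rbrakk>\<^bsub>N\<^esub>" if "x \<in> carrier L" "y \<in> carrier L" for x y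
  proof (rule f.hom_bracketI[OF L.E_image_carrier[OF order_refl] L.span_E _ that])
    have HH: "?good (E kH) (E kH)" by (simp add: simps L.bracket_self N.bracket_self)
    have HP: "?good (E kH) (E (kP i))" if "i \<in> I" for i using that by (simp add: simps)
    have KH: "?good (E (kK i)) (E kH)" if "i \<in> I" for i using that by (simp add: simps)
    have PP: "?good (E (kP i)) (E (kP j))" if "i \<in> I" "j \<in> I" for i j using that by (simp add: simps)
    have KP: "?good (E (kK i)) (E (kP j))" if "i \<in> I" "j \<in> I" for i j using that by (simp add: simps)
    have KK: "?good (E (kK i)) (E (kK j))" if "i \<in> I" "j \<in> I" for i j using that by (simp add: simps)
    have JH: "?good (E (kJ i j)) (E kH)" if "i \<in> I" "j \<in> I" for i j using that by (simp add: simps)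
    have JP: "?good (E (kJ i j)) (E (kP k))" if "i \<in> I" "j \<in> I" "k \<in> I" for i j k
      using that by (simp add: simps)
    have JK: "?good (E (kJ i j)) (E (kK k))" if "i \<in> I" "j \<in> I" "k \<in> I" for i j k
      using that by (simp add: simps)
    have JJ: "?good (E (kJ i j)) (E (kJ k l))" if "i \<in> I" "j \<in> I" "k \<in> I" "l \<in> I" for i j k l
      using that by (simp add: simps L.J_bracket_J N.J_bracket_J del: of_bool_eq_iff)
    note good = HH HP KH PP KP KK JH JP JK JJ
    \<comment> \<open>Each pair of labels is covered by one of the cases above or by its mirror
      image through \<open>sym\<close>.\<close>
    have good: "?good (E a) (E b)" if "a \<in> kin_labels I" "b \<in> kin_labels I" for a b
      using that by (cases a; cases b) (auto intro: good sym)
    show "?good s t" if "s \<in> E ` kin_labels I" "t \<in> E ` kin_labels I" for s t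
      using that good by auto
  qed
  moreover have "f ` hh = hN"
  proof -
    have S: "kin_labels I - ({kH} \<union> kP ` I) \<subseteq> kin_labels I" by auto
    have "f ` E ` (kin_labels I - ({kH} \<union> kP ` I)) = Z ` (kin_labels I - ({kH} \<union> kP ` I))"
      unfolding image_image by (rule image_cong) (auto simp: fE)
    then show ?thesis
      unfolding L.hh_span N.hh_span by (simp only: f.hom_span[OF L.E_image_carrier[OF S]])
  qed
  ultimately show ?thesis
    unfolding klein_isomorphic_def using bij add smult by blast
qed

section \<open>The contracted pair\<close>

text \<open>A right inverse of \<open>reduced_label\<close>. On the indices \<open>{1..d}\<close> it
  names the generators that survive in the quotient by \<open>ii\<close>.\<close>

fun kin_to_red :: "kin_label \<Rightarrow> red_label" where
  "kin_to_red kH = rH"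
| "kin_to_red (kP i) = rP i"
| "kin_to_red (kK i) = rK i"
| "kin_to_red (kJ i j) = rJ i j"

lemma red_labels_simps [simp]:
  "rM \<in> red_labels d" "rH \<in> red_labels d" "rC \<in> red_labels d"
  "rP i \<in> red_labels d \<longleftrightarrow> i \<in> {1..d}" "rD i \<in> red_labels d \<longleftrightarrow> i \<in> {1..d}"
  "rK i \<in> red_labels d \<longleftrightarrow> i \<in> {1..d}"
  "rJ i j \<in> red_labels d \<longleftrightarrow> i \<in> {1..d} \<and> j \<in> {1..d} \<and> i < j"
  by (auto simp: red_labels_def rJ_labels_def)

lemma red_labels_h_subset: "red_labels_h d \<subseteq> red_labels d"
  and red_labels_i_subset: "red_labels_i d \<subseteq> red_labels d"
  and red_labels_k_Un_i: "red_labels_k d \<union> red_labels_i d = red_labels d"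
  and red_labels_k_Int_i: "red_labels_k d \<inter> red_labels_i d = {}"
  by (auto simp: red_labels_h_def red_labels_i_def red_labels_k_def red_labels_def rJ_labels_def)

lemma red_labels_minus_i: "red_labels d - red_labels_i d = red_labels_k d"
  using red_labels_k_Un_i[of d] red_labels_k_Int_i[of d] by blast

lemma kin_to_red_J:
  "kin_to_red ` {kJ i j | i j. i \<in> {1..d} \<and> j \<in> {1..d} \<and> i < j} = rJ_labels d"
proof
  show "rJ_labels d \<subseteq> kin_to_red ` {kJ i j | i j. i \<in> {1..d} \<and> j \<in> {1..d} \<and> i < j}"
  proof
    fix b assume "b \<in> rJ_labels d"
    then obtain i j where "b = rJ i j" "i \<in> {1..d}" "j \<in> {1..d}" "i < j" by (auto simp: rJ_labels_def)
    then show "b \<in> kin_to_red ` {kJ i j | i j. i \<in> {1..d} \<and> j \<in> {1..d} \<and> i < j}"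
      by (intro image_eqI[of _ _ "kJ i j"]) auto
  qed
qed (auto simp: rJ_labels_def)

lemma bij_betw_kin_to_red: "bij_betw kin_to_red (kin_labels {1..d}) (red_labels_k d)"
  unfolding bij_betw_def
proof
  show "inj_on kin_to_red (kin_labels {1..d})"
    by (rule inj_onI, elim kin_to_red.elims) auto
  show "kin_to_red ` kin_labels {1..d} = red_labels_k d"
    by (simp only: kin_labels_def red_labels_k_def image_Un image_insert image_empty image_image
        kin_to_red.simps kin_to_red_J)
qed

text \<open>Indices in \<open>red_labels d\<close> start at 1, so labels with an index 0 come only
  from \<open>rM\<close>, \<open>rC\<close> and \<open>rD\<close>. The choice \<open>J_0i\<close>
  rather than \<open>J_i0\<close> for \<open>D_i\<close> agrees with the ordering
  \<open>i < j\<close> in \<open>kin_labels\<close>.\<close>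

lemma bij_betw_reduced_label: "bij_betw reduced_label (red_labels d) (kin_labels {0..d})"
  unfolding bij_betw_def
proof
  show "inj_on reduced_label (red_labels d)"
  proof (rule inj_onI)
    fix a b assume "a \<in> red_labels d" "b \<in> red_labels d" "reduced_label a = reduced_label b"
    then show "a = b" by (cases a; cases b) auto
  qed
  show "reduced_label ` red_labels d = kin_labels {0..d}"
  proof
    show "reduced_label ` red_labels d \<subseteq> kin_labels {0..d}"
      by (auto simp: red_labels_def rJ_labels_def kin_labels_def)
    show "kin_labels {0..d} \<subseteq> reduced_label ` red_labels d"
    proof
      fix b assume b: "b \<in> kin_labels {0..d}"
      show "b \<in> reduced_label ` red_labels d"
      proof (cases b)
        case kH
        then show ?thesis by (auto intro: image_eqI[of _ _ rH])
      next
        case (kP i)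
        then show ?thesis using b
          by (cases "i = 0") (auto simp: kin_labels_def intro: image_eqI[of _ _ rM] image_eqI[of _ _ "rP i"])
      next
        case (kK i)
        then show ?thesis using b
          by (cases "i = 0") (auto simp: kin_labels_def intro: image_eqI[of _ _ rC] image_eqI[of _ _ "rK i"])
      next
        case (kJ i j)
        then show ?thesis using b
          by (cases "i = 0") (auto simp: kin_labels_def intro: image_eqI[of _ _ "rD j"] image_eqI[of _ _ "rJ i j"])
      qed
    qed
  qed
qed

lemma reduced_label_h:
  "reduced_label ` red_labels_h d = kin_labels {0..d} - ({kH} \<union> kP ` {0..d})"
proof -
  have "red_labels_h d = {b \<in> red_labels d. reduced_label b \<notin> {kH} \<union> kP ` {0..d}}"
    by (auto simp: red_labels_h_def red_labels_def rJ_labels_def)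
  moreover have "reduced_label ` red_labels d = kin_labels {0..d}"
    using bij_betw_reduced_label by (simp add: bij_betw_def)
  moreover have "f ` {b \<in> A. f b \<notin> T} = f ` A - T" for f :: "red_label \<Rightarrow> kin_label" and A T
    by auto
  ultimately show ?thesis by (simp only:)
qed

text \<open>Effectiveness and the shape of the quotient depend only on generators and relations, so
  they are derived from those without reference to how \<open>G\<close> arose by
  contraction.\<close>

locale contracted_pair = lie_algebra G for G :: "'a lie_algebra" (structure) +
  fixes \<epsilon> \<omega> :: real and d :: nat and hh :: "'a set" and Y :: "red_label \<Rightarrow> 'a"
  assumes reduced: "reduced_klein_pair G d hh Y"
    and commutators: "contracted_commutators \<epsilon> \<omega> G d Y"
begin

lemma basis: "is_basis G (red_labels d) Y"
  and hh_span: "hh = lin_span G (Y ` red_labels_h d)"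
  and hh_subalgebra: "lie_subalgebra G hh"
  and J_rotations: "rotations G {1..d} (\<lambda>i j. Y (rJ i j))"
  and P_vector: "vector_module G {1..d} (\<lambda>i j. Y (rJ i j)) (\<lambda>i. Y (rP i))"
  and K_vector: "vector_module G {1..d} (\<lambda>i j. Y (rJ i j)) (\<lambda>i. Y (rK i))"
  and H_scalar: "scalar_module G {1..d} (\<lambda>i j. Y (rJ i j)) (Y rH)"
  using reduced unfolding reduced_klein_pair_def klein_pair_def Let_def by blast+

sublocale lie_algebra_basis G "red_labels d" Y
  by unfold_locales (rule basis)

lemma generators_carrier [simp]:
  "Y rM \<in> carrier G" "Y rH \<in> carrier G" "Y rC \<in> carrier G"
  "i \<in> {1..d} \<Longrightarrow> Y (rP i) \<in> carrier G" "i \<in> {1..d} \<Longrightarrow> Y (rD i) \<in> carrier G"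
  "i \<in> {1..d} \<Longrightarrow> Y (rK i) \<in> carrier G"
  "i \<in> {1..d} \<Longrightarrow> j \<in> {1..d} \<Longrightarrow> Y (rJ i j) \<in> carrier G"
  using E_carrier rotations_carrier[OF J_rotations] by simp_all

lemma CH: "\<lbrakk>Y rC, Y rH\<rbrakk> = Y rM"
  using commutators by (simp add: contracted_commutators_def Let_def)

lemma brackets:
  assumes "i \<in> {1..d}"
  shows "\<lbrakk>Y (rK i), Y rH\<rbrakk> = Y (rP i)"
    and "\<lbrakk>Y rH, Y (rP i)\<rbrakk> = \<epsilon> \<odot> Y (rK i) \<oplus>\<^bsub>G\<^esub> \<omega> \<odot> Y (rP i)"
    and "\<lbrakk>Y rC, Y (rP i)\<rbrakk> = \<zero>\<^bsub>G\<^esub>" and "\<lbrakk>Y rH, Y (rD i)\<rbrakk> = \<zero>\<^bsub>G\<^esub>" and "\<lbrakk>Y (rD i), Y rH\<rbrakk> = \<zero>\<^bsub>G\<^esub>"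
    and "j \<in> {1..d} \<Longrightarrow> \<lbrakk>Y (rD i), Y (rP j)\<rbrakk> = of_bool (i = j) \<odot> Y rM"
    and "j \<in> {1..d} \<Longrightarrow> \<lbrakk>Y (rK i), Y (rP j)\<rbrakk> = \<zero>\<^bsub>G\<^esub>"
    and "j \<in> {1..d} \<Longrightarrow> \<lbrakk>Y (rK i), Y (rK j)\<rbrakk> = \<zero>\<^bsub>G\<^esub>"
    and "j \<in> {1..d} \<Longrightarrow> \<lbrakk>Y (rP i), Y (rP j)\<rbrakk> = \<zero>\<^bsub>G\<^esub>"
    and "j \<in> {1..d} \<Longrightarrow> \<lbrakk>Y (rJ i j), Y rH\<rbrakk> = \<zero>\<^bsub>G\<^esub>"
proof -
  show HD: "\<lbrakk>Y rH, Y (rD i)\<rbrakk> = \<zero>\<^bsub>G\<^esub>"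
    using assms commutators by (simp add: contracted_commutators_def Let_def)
  show "\<lbrakk>Y (rD i), Y rH\<rbrakk> = \<zero>\<^bsub>G\<^esub>"
    using assms HD bracket_swap[of "Y (rD i)" "Y rH"] by simp
qed (use assms commutators H_scalar in
    \<open>simp_all add: contracted_commutators_def Let_def scalar_module_def del: of_bool_eq_iff\<close>)

lemmas J_bracket_P = vector_module_bracket[OF P_vector]

text \<open>The \<open>M\<close>-coordinate detects \<open>C\<close> through
  \<open>[C, H] = M\<close> and \<open>D_i\<close> through \<open>[D_i, P_i] = M\<close>. The
  generators \<open>K_i\<close> and \<open>J_ij\<close> are detected along \<open>P_i\<close> as in
  a galilean pair; the extra values along \<open>M\<close> have no
  \<open>P_i\<close>-coordinate.\<close>

lemma effective: "effective_klein_pair G hh"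
  unfolding hh_span
proof (rule effective_klein_pairI[OF _ red_labels_h_subset])
  show "lie_subalgebra G (lin_span G (Y ` red_labels_h d))"
    using hh_subalgebra by (simp add: hh_span)
  have not_h: "rM \<in> red_labels d - red_labels_h d" "i \<in> {1..d} \<Longrightarrow> rP i \<in> red_labels d - red_labels_h d" for i
    by (auto simp: red_labels_h_def rJ_labels_def)
  fix s assume s: "s \<in> red_labels_h d"
  then consider (C) "s = rC" | (D) i where "s = rD i" "i \<in> {1..d}"
    | (K) i where "s = rK i" "i \<in> {1..d}" | (J) i j where "s = rJ i j" "i \<in> {1..d}" "j \<in> {1..d}" "i < j"
    unfolding red_labels_h_def rJ_labels_def by blast
  then show "\<exists>y\<in>carrier G. \<exists>t\<in>red_labels d - red_labels_h d.
      \<forall>s'\<in>red_labels_h d. coord \<lbrakk>Y s', y\<rbrakk> t = of_bool (s' = s)"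
  proof cases
    case C
    then show ?thesis
      by (intro bexI[of _ "Y rH"] bexI[of _ rM, OF _ not_h(1)])
        (auto simp: red_labels_h_def rJ_labels_def CH brackets coord_E coord_zero)
  next
    case D
    then show ?thesis
      by (intro bexI[of _ "Y (rP i)"] bexI[of _ rM, OF _ not_h(1)])
        (auto simp: red_labels_h_def rJ_labels_def of_bool_def brackets J_bracket_P
          coord_E coord_zero coord_add coord_minus coord_smult split: if_splits)
  next
    case K
    then show ?thesis
      by (intro bexI[of _ "Y rH"] bexI[of _ "rP i", OF _ not_h(2)])
        (auto simp: red_labels_h_def rJ_labels_def CH brackets coord_E coord_zero)
  next
    case J
    then show ?thesis
      by (intro bexI[of _ "Y (rP j)"] bexI[of _ "rP i", OF _ not_h(2)])
        (auto simp: red_labels_h_def rJ_labels_def of_bool_def brackets J_bracket_P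
          coord_E coord_zero coord_add coord_minus coord_smult split: if_splits)
  qed
qed

text \<open>The projection carries over the relations among \<open>H\<close>, \<open>P\<close>,
  \<open>K\<close> and \<open>J\<close>, which are already galilean for \<open>d\<close> dimensions,
  and the classes of \<open>M\<close>, \<open>C\<close> and \<open>D\<close> vanish.\<close>

lemma quotient_galilean:
  assumes ideal: "lie_ideal G (lin_span G (Y ` red_labels_i d))"
  defines "ii \<equiv> lin_span G (Y ` red_labels_i d)"
  shows "galilean_klein_pair \<epsilon> \<omega> (lie_quotient G ii) {1..d} (quotient_image G ii hh)
    (\<lambda>l. ii +>\<^bsub>G\<^esub> Y (kin_to_red l))"
proof -
  interpret ii: lie_algebra_ideal G ii
    by unfold_locales (use ideal in \<open>simp add: ii_def\<close>)
  interpret pr: lie_algebra_hom G ii.Q ii.proj by (rule ii.proj_hom)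
  let ?Z = "\<lambda>l. ii.proj (Y (kin_to_red l))"
  have h: "Y ` red_labels_h d \<subseteq> carrier G" by (rule E_image_carrier[OF red_labels_h_subset])
  have Qbasis: "is_basis ii.Q (red_labels_k d) (\<lambda>b. ii.proj (Y b))"
    using is_basis_quotient[OF red_labels_i_subset ideal] by (simp add: ii_def red_labels_minus_i)
  interpret Q: lie_algebra_basis ii.Q "red_labels_k d" "\<lambda>b. ii.proj (Y b)"
    by unfold_locales (rule Qbasis)
  have basis: "is_basis ii.Q (kin_labels {1..d}) ?Z"
    using Q.is_basis_reindex[OF bij_betw_kin_to_red] by (simp add: comp_def)
  have "lie_subalgebra ii.Q (ii.proj ` hh)"
    unfolding lie_subalgebra_def
  proof
    show "lin_subspace ii.Q (ii.proj ` hh)"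
      unfolding hh_span pr.hom_span[OF h] by (rule pr.cod.span_subspace) (use h in auto)
    have "\<lbrakk>ii.proj x, ii.proj y\<rbrakk>\<^bsub>ii.Q\<^esub> \<in> ii.proj ` hh" if "x \<in> hh" "y \<in> hh" for x y
      using that hh_subalgebra pr.hom_bracket[of x y, symmetric] subspaceD(6)[of hh]
      by (simp add: lie_subalgebra_def)
    then show "\<forall>x\<in>ii.proj ` hh. \<forall>y\<in>ii.proj ` hh. \<lbrakk>x, y\<rbrakk>\<^bsub>ii.Q\<^esub> \<in> ii.proj ` hh" by blast
  qed
  then have klein: "klein_pair ii.Q (quotient_image G ii hh)"
    using pr.cod.lie_algebra_axioms by (simp add: klein_pair_def quotient_image_def)
  have in_ii: "ii.proj (Y b) = \<zero>\<^bsub>ii.Q\<^esub>" if "b \<in> red_labels_i d" for b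
  proof -
    have "Y b \<in> ii" unfolding ii_def using that by (auto intro: span_base)
    then show ?thesis using ii.proj_eq_V_iff[OF ii.V_carrier] by (simp add: ii.quotient_simps)
  qed
  let ?T = "?Z ` (kin_labels {1..d} - ({kH} \<union> kP ` {1..d}))"
  have T: "?T \<subseteq> carrier ii.Q" using basis by (auto simp: is_basis_def)
  \<comment> \<open>Besides the labels of the smaller isotropy algebra, \<open>hh\<close> contains
    only \<open>C\<close> and the \<open>D_i\<close>, whose classes are zero; hence both spanning
    sets give the same image.\<close>
  have h_split: "red_labels_h d = {rC} \<union> rD ` {1..d} \<union> kin_to_red ` (kin_labels {1..d} - ({kH} \<union> kP ` {1..d}))"
    by (simp only: red_labels_h_def kin_labels_h image_Un image_image kin_to_red.simps kin_to_red_J Un_assoc)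
  have hh: "quotient_image G ii hh = lin_span ii.Q ?T"
    unfolding quotient_image_def hh_span pr.hom_span[OF h]
  proof
    show "lin_span ii.Q (ii.proj ` Y ` red_labels_h d) \<subseteq> lin_span ii.Q ?T"
    proof (rule pr.cod.span_le_span[OF _ T])
      show "ii.proj ` Y ` red_labels_h d \<subseteq> lin_span ii.Q ?T"
        using pr.cod.subspaceD(2)[OF pr.cod.span_subspace[OF T]] in_ii
        unfolding h_split by (auto simp: red_labels_i_def intro: pr.cod.span_base)
    qed
    show "lin_span ii.Q ?T \<subseteq> lin_span ii.Q (ii.proj ` Y ` red_labels_h d)"
    proof (rule pr.cod.span_le_span)
      have "?T \<subseteq> ii.proj ` Y ` red_labels_h d" unfolding h_split by auto
      then show "?T \<subseteq> lin_span ii.Q (ii.proj ` Y ` red_labels_h d)"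
        using pr.cod.span_superset by (rule subset_trans)
      show "ii.proj ` Y ` red_labels_h d \<subseteq> carrier ii.Q" using h by auto
    qed
  qed
  have mods: "rotations ii.Q {1..d} (\<lambda>i j. ii.proj (Y (rJ i j)))"
    "vector_module ii.Q {1..d} (\<lambda>i j. ii.proj (Y (rJ i j))) (\<lambda>i. ii.proj (Y (rP i)))"
    "vector_module ii.Q {1..d} (\<lambda>i j. ii.proj (Y (rJ i j))) (\<lambda>i. ii.proj (Y (rK i)))"
    "scalar_module ii.Q {1..d} (\<lambda>i j. ii.proj (Y (rJ i j))) (ii.proj (Y rH))"
    by (rule pr.hom_rotations[OF J_rotations], rule pr.hom_vector_module[OF P_vector], simp, simp,
        rule pr.hom_vector_module[OF K_vector], simp, simp, rule pr.hom_scalar_module[OF H_scalar], simp, simp)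
  show ?thesis
    unfolding galilean_klein_pair_def kinematical_klein_pair_def
    using klein basis hh mods
    by (simp add: pr.hom_bracket[symmetric] pr.hom_add[symmetric] pr.hom_smult[symmetric] brackets
        in_ii pr.hom_zero)
qed

end

text \<open>Stability under \<open>pk\<close> gives stability under \<open>pi\<close>, the identity
  minus \<open>pk\<close>; then each of the three summands of the contracted bracket stays in
  \<open>V\<close>.\<close>

lemma (in lie_splitting) lie_subalgebra_contraction:
  assumes V: "lie_subalgebra L V" and pkV: "\<And>x. x \<in> V \<Longrightarrow> pk x \<in> V"
  shows "lie_subalgebra G V"
proof -
  have Vs: "lin_subspace L V" using V by (simp add: lie_subalgebra_def)
  note D = subspaceD[OF Vs]
  have piV: "pi x \<in> V" if "x \<in> V" for x
  proof -
    have "pi x = \<ominus>\<^bsub>L\<^esub> pk x \<oplus>\<^bsub>L\<^esub> x"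
      using that D(6) pk_pi[of x] M.r_neg1[of "pk x" "pi x"] by simp
    then show ?thesis using that pkV D(3,5) by simp
  qed
  show ?thesis
    unfolding lie_subalgebra_def
    using Vs V pkV piV D(3) by (simp add: contraction_bracket lie_subalgebra_def)
qed

section \<open>Dimensional reduction and the final assembly\<close>

context galilean
begin

lemma reduced_klein_pair:
  assumes I: "I = {0..d}"
  shows "reduced_klein_pair L d hh (dim_reduction E)"
proof -
  let ?J = "\<lambda>i j. E (kJ i j)"
  have sub: "rotations L {1..d} ?J"
    using J_rotations unfolding rotations_def I by (meson atLeastAtMost_iff le0)
  have P: "vector_module L {1..d} ?J (\<lambda>i. E (kP i))" and K: "vector_module L {1..d} ?J (\<lambda>i. E (kK i))"
    and H: "scalar_module L {1..d} ?J (E kH)"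
    using P_vector K_vector H_scalar unfolding vector_module_def scalar_module_def I by auto
  have D: "vector_module L {1..d} ?J (\<lambda>i. E (kJ 0 i))"
    unfolding vector_module_def
  proof (intro ballI)
    fix i j k assume i: "i \<in> {1..d}" "j \<in> {1..d}" "k \<in> {1..d}"
    \<comment> \<open>With \<open>i\<close> and \<open>j\<close> at least 1, the relation for
      \<open>[J_ij, J_0k]\<close> keeps only its terms in \<open>J_i0\<close> and
      \<open>J_j0\<close>; flipping these to \<open>J_0i\<close> and \<open>J_0j\<close> gives the
      signs of the vector rule.\<close>
    then have "E (kJ i 0) = \<ominus>\<^bsub>L\<^esub> E (kJ 0 i)" "E (kJ j 0) = \<ominus>\<^bsub>L\<^esub> E (kJ 0 j)"
      using rotations_swap[OF J_rotations, of i 0] rotations_swap[OF J_rotations, of j 0] I by simp_all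
    then show "\<lbrakk>E (kJ i j), E (kJ 0 k)\<rbrakk> =
        \<ominus>\<^bsub>L\<^esub> (of_bool (i = k) \<odot> E (kJ 0 j)) \<oplus>\<^bsub>L\<^esub> of_bool (j = k) \<odot> E (kJ 0 i)"
      using i I J_bracket_J[of i j 0 k] generators_carrier(4)[of 0 i] generators_carrier(4)[of 0 j]
      by (cases "i = k"; cases "j = k") (simp_all add: a_minus_def M.l_neg M.r_neg)
  qed
  \<comment> \<open>Rotations among the indices \<open>1..d\<close> never match the index 0, so both
    terms of the vector rule vanish on \<open>P_0\<close> and \<open>K_0\<close>.\<close>
  have M: "scalar_module L {1..d} ?J (E (kP 0))" and C: "scalar_module L {1..d} ?J (E (kK 0))"
    using J_bracket_P[of _ _ 0] J_bracket_K[of _ _ 0] I by (auto simp: scalar_module_def)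
  have "hh = lin_span L ((E \<circ> reduced_label) ` red_labels_h d)"
    unfolding image_comp[symmetric] reduced_label_h hh_span I ..
  moreover have "is_basis L (red_labels d) (E \<circ> reduced_label)"
    by (rule is_basis_reindex) (use bij_betw_reduced_label I in simp)
  ultimately show ?thesis
    using sub P K H D M C hh_subalgebra lie_algebra_axioms
    by (simp add: reduced_klein_pair_def Let_def klein_pair_def dim_reduction_def)
qed

end

text \<open>\<open>N\<close> may live on a type unrelated to that of \<open>L\<close>. The clause
  asserting that the quotient itself is galilean gives content independent of whether the type of
  \<open>N\<close> carries any such pair.\<close>

theorem proposition6p4:
  fixes L :: "'a lie_algebra" and \<epsilon> \<omega> :: real and d :: nat
    and hh :: "'a set" and E :: "kin_label \<Rightarrow> 'a"
  assumes "(\<epsilon>, \<omega>) \<in> {(0, 0), (0, 1), (1, 0), (-1, 0)}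
             \<union> {(1, \<alpha>) | \<alpha>. \<alpha> > 0} \<union> {(-1, \<alpha>) | \<alpha>. \<alpha> > 0}"
    and "galilean_klein_pair \<epsilon> \<omega> L {0..d} hh E"
  shows "let Y = dim_reduction E;
             kk = lin_span L (Y ` red_labels_k d);
             ii = lin_span L (Y ` red_labels_i d);
             G = iw_contraction L kk ii
         in reduced_klein_pair L d hh Y \<and>
            splitting L kk ii \<and> lie_subalgebra L kk \<and>
            projectable_triplet G hh ii \<and>
            reduced_klein_pair G d hh Y \<and>
            contracted_commutators \<epsilon> \<omega> G d Y \<and>
            (\<exists>Z. galilean_klein_pair \<epsilon> \<omega> (lie_quotient G ii) {1..d} (quotient_image G ii hh) Z) \<and>
            (\<forall>(N :: 'b lie_algebra) hN Z.
               galilean_klein_pair \<epsilon> \<omega> N {1..d} hN Z \<longrightarrow> lifts G hh ii N hN)"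
proof -
  have "lie_algebra L"
    using assms(2) by (simp add: galilean_klein_pair_def kinematical_klein_pair_def klein_pair_def)
  then interpret L: galilean L \<epsilon> \<omega> "{0..d}" hh E
    using assms(2) by (intro galilean.intro galilean_axioms.intro)
  define Y where "Y = dim_reduction E"
  have Y [simp]: "Y rM = E (kP 0)" "Y rH = E kH" "Y rC = E (kK 0)" "Y (rP i) = E (kP i)"
    "Y (rD i) = E (kJ 0 i)" "Y (rK i) = E (kK i)" "Y (rJ i j) = E (kJ i j)" for i j
    by (simp_all add: Y_def dim_reduction_def)
  have red: "reduced_klein_pair L d hh Y" unfolding Y_def by (rule L.reduced_klein_pair) simp
  then have Ybasis: "is_basis L (red_labels d) Y"
    and hh: "hh = lin_span L (Y ` red_labels_h d)" "lie_subalgebra L hh"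
    and J: "rotations L {1..d} (\<lambda>i j. Y (rJ i j))"
    and P: "vector_module L {1..d} (\<lambda>i j. Y (rJ i j)) (\<lambda>i. Y (rP i))"
    and D: "vector_module L {1..d} (\<lambda>i j. Y (rJ i j)) (\<lambda>i. Y (rD i))"
    and K: "vector_module L {1..d} (\<lambda>i j. Y (rJ i j)) (\<lambda>i. Y (rK i))"
    and M: "scalar_module L {1..d} (\<lambda>i j. Y (rJ i j)) (Y rM)"
    and H: "scalar_module L {1..d} (\<lambda>i j. Y (rJ i j)) (Y rH)"
    and C: "scalar_module L {1..d} (\<lambda>i j. Y (rJ i j)) (Y rC)"
    unfolding reduced_klein_pair_def klein_pair_def Let_def by blast+
  interpret Y: lie_algebra_basis L "red_labels d" Y by unfold_locales (rule Ybasis)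
  define kk where "kk = lin_span L (Y ` red_labels_k d)"
  define ii where "ii = lin_span L (Y ` red_labels_i d)"
  have k_carrier: "Y ` red_labels_k d \<subseteq> carrier L"
    using Y.E_image_carrier red_labels_k_Un_i[of d] by blast
  have kks: "lin_subspace L kk" unfolding kk_def by (rule L.span_subspace[OF k_carrier])
  have in_kk: "Y b \<in> kk" if "b \<in> red_labels_k d" for b
    unfolding kk_def using that by (auto intro: L.span_base)
  have in_ii: "Y b \<in> ii" if "b \<in> red_labels_i d" for b
    unfolding ii_def using that by (auto intro: L.span_base)
  have gen_k: "E kH \<in> kk" "i \<in> {1..d} \<Longrightarrow> E (kP i) \<in> kk" "i \<in> {1..d} \<Longrightarrow> E (kK i) \<in> kk" for i
    using in_kk[of rH] in_kk[of "rP i"] in_kk[of "rK i"] by (auto simp: red_labels_k_def)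
  have gen_i: "E (kP 0) \<in> ii" "E (kK 0) \<in> ii" "i \<in> {1..d} \<Longrightarrow> E (kJ 0 i) \<in> ii" for i
    using in_ii[of rM] in_ii[of rC] in_ii[of "rD i"] by (auto simp: red_labels_i_def)
  \<comment> \<open>The generators of \<open>kk\<close> contain rotations only for
    \<open>i < j\<close>, whereas the module relations need all pairs.\<close>
  have J_kk: "Y (rJ i j) \<in> kk" if "i \<in> {1..d}" "j \<in> {1..d}" for i j
    by (rule L.rotations_in_subspace[OF kks J _ that])
      (rule in_kk, auto simp: red_labels_k_def rJ_labels_def)
  have split: "splitting L kk ii"
    unfolding kk_def ii_def by (rule Y.splitting_span[OF red_labels_k_Int_i red_labels_k_Un_i])
  have sub: "lie_subalgebra L kk"
    unfolding kk_def
  proof (rule L.lie_subalgebra_spanI[OF k_carrier], fold kk_def)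
    note kD = L.subspaceD[OF kks]
    have HP: "\<lbrakk>E kH, E (kP i)\<rbrakk>\<^bsub>L\<^esub> \<in> kk" if "i \<in> {1..d}" for i
      using that gen_k kD by (simp add: L.brackets)
    have KH: "\<lbrakk>E (kK i), E kH\<rbrakk>\<^bsub>L\<^esub> \<in> kk" if "i \<in> {1..d}" for i
      using that gen_k by (simp add: L.brackets)
    have vec: "\<lbrakk>E (kP i), E (kP j)\<rbrakk>\<^bsub>L\<^esub> \<in> kk" "\<lbrakk>E (kK i), E (kP j)\<rbrakk>\<^bsub>L\<^esub> \<in> kk"
      "\<lbrakk>E (kK i), E (kK j)\<rbrakk>\<^bsub>L\<^esub> \<in> kk" "\<lbrakk>E (kJ i j), E kH\<rbrakk>\<^bsub>L\<^esub> \<in> kk"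
      if "i \<in> {1..d}" "j \<in> {1..d}" for i j
      using that kD(2) by (simp_all add: L.brackets)
    have HH: "\<lbrakk>E kH, E kH\<rbrakk>\<^bsub>L\<^esub> \<in> kk" using kD(2) by (simp add: L.bracket_self)
    have JP: "\<lbrakk>E (kJ i j), E (kP k)\<rbrakk>\<^bsub>L\<^esub> \<in> kk" "\<lbrakk>E (kJ i j), E (kK k)\<rbrakk>\<^bsub>L\<^esub> \<in> kk"
      if "i \<in> {1..d}" "j \<in> {1..d}" "k \<in> {1..d}" for i j k
      using L.vector_module_bracket_in_subspace[OF kks P _ that]
        L.vector_module_bracket_in_subspace[OF kks K _ that] gen_k by simp_all
    have JJ: "\<lbrakk>E (kJ i j), E (kJ k l)\<rbrakk>\<^bsub>L\<^esub> \<in> kk"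
      if "i \<in> {1..d}" "j \<in> {1..d}" "k \<in> {1..d}" "l \<in> {1..d}" for i j k l
      using L.rotations_bracket_in_subspace[OF kks J _ that] J_kk by simp
    fix s t assume "s \<in> Y ` red_labels_k d" "t \<in> Y ` red_labels_k d"
    then show "\<lbrakk>s, t\<rbrakk>\<^bsub>L\<^esub> \<in> kk \<or> \<lbrakk>t, s\<rbrakk>\<^bsub>L\<^esub> \<in> kk"
      unfolding red_labels_k_def rJ_labels_def
      by (auto simp del: atLeastAtMost_iff simp: HP KH vec HH JP JJ)
  qed
  interpret S: lie_splitting L kk ii
    by unfold_locales (fact split sub)+
  note iD = L.subspaceD[OF S.ii]
  interpret G: lie_algebra S.G by (rule S.lie_algebra_contraction)
  have HD: "\<lbrakk>E kH, E (kJ 0 i)\<rbrakk>\<^bsub>L\<^esub> = \<zero>\<^bsub>L\<^esub>" if "i \<in> {1..d}" for i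
    using that L.bracket_swap[of "E kH" "E (kJ 0 i)"] by (simp add: L.brackets)
  have zero_ii: "\<zero>\<^bsub>L\<^esub> \<in> ii" by (rule iD(2))
  \<comment> \<open>Brackets within \<open>kk\<close> are kept, and mixed brackets already lie in
    \<open>ii\<close>, so the projection fixes them. Only brackets within \<open>ii\<close> change:
    \<open>[D, D]\<close>, \<open>[D, M]\<close> and \<open>[D, C]\<close> become zero.\<close>
  have comm: "contracted_commutators \<epsilon> \<omega> S.G d Y"
    unfolding contracted_commutators_def Let_def
    using gen_k gen_i zero_ii iD(3,4)
    by (auto simp: S.contraction_bracket_kk S.contraction_bracket_ki S.contraction_bracket_ik
        S.contraction_bracket_ii L.brackets L.J_bracket_P L.J_bracket_K HD)
  \<comment> \<open>Every generator of \<open>hh\<close> lies in \<open>kk\<close> or in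
    \<open>ii\<close>, so \<open>pk\<close> fixes it or sends it to zero. This compatibility with
    the splitting keeps \<open>hh\<close> a subalgebra after contraction.\<close>
  have "S.pk x \<in> hh" if "x \<in> hh" for x
  proof -
    have h: "Y ` red_labels_h d \<subseteq> carrier L" by (rule Y.E_image_carrier[OF red_labels_h_subset])
    note hD = L.subspaceD[OF L.span_subspace[OF h]]
    have "x \<in> lin_span L (Y ` red_labels_h d)" using that hh by simp
    then show ?thesis unfolding hh(1) using h
    proof (induction rule: L.span_induct)
      case (base s)
      then obtain b where b: "b \<in> red_labels_h d" "s = Y b" by auto
      then have "s \<in> kk \<or> s \<in> ii"
        using red_labels_h_subset red_labels_k_Un_i in_kk in_ii by blast
      then show ?case using base hD(2) by (auto intro: L.span_base)
    next
      case zero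
      then show ?case using hD(2) zero_ii by simp
    qed (use hD(3,4) in \<open>simp_all add: S.pk_plus S.pk_smult\<close>)
  qed
  then have "lie_subalgebra S.G hh" by (rule S.lie_subalgebra_contraction[OF hh(2)])
  moreover have "rotations S.G {1..d} (\<lambda>i j. Y (rJ i j))"
    by (rule S.contraction_rotations[OF J J_kk])
  moreover have "vector_module S.G {1..d} (\<lambda>i j. Y (rJ i j)) (\<lambda>i. Y (rP i))"
    "vector_module S.G {1..d} (\<lambda>i j. Y (rJ i j)) (\<lambda>i. Y (rD i))"
    "vector_module S.G {1..d} (\<lambda>i j. Y (rJ i j)) (\<lambda>i. Y (rK i))"
    using S.contraction_vector_module[OF P J_kk] S.contraction_vector_module[OF D J_kk]
      S.contraction_vector_module[OF K J_kk] gen_k gen_i by simp_all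
  moreover have "scalar_module S.G {1..d} (\<lambda>i j. Y (rJ i j)) (Y rM)"
    "scalar_module S.G {1..d} (\<lambda>i j. Y (rJ i j)) (Y rH)"
    "scalar_module S.G {1..d} (\<lambda>i j. Y (rJ i j)) (Y rC)"
    using S.contraction_scalar_module[OF M J_kk] S.contraction_scalar_module[OF H J_kk]
      S.contraction_scalar_module[OF C J_kk] gen_k gen_i by simp_all
  ultimately have redG: "reduced_klein_pair S.G d hh Y"
    using Ybasis hh(1) G.lie_algebra_axioms
    by (simp add: reduced_klein_pair_def klein_pair_def Let_def)
  interpret G: contracted_pair S.G \<epsilon> \<omega> d hh Y
    by unfold_locales (fact redG comm)+
  have ideal: "lie_ideal S.G ii" by (rule S.lie_ideal_contraction)
  have ii_G: "ii = lin_span S.G (Y ` red_labels_i d)"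
    by (simp only: S.contraction_span) (rule ii_def)
  have galQ: "galilean_klein_pair \<epsilon> \<omega> (lie_quotient S.G ii) {1..d} (quotient_image S.G ii hh)
      (\<lambda>l. ii +>\<^bsub>S.G\<^esub> Y (kin_to_red l))"
    by (rule G.quotient_galilean[folded ii_G, OF ideal])
  then have "galilean (lie_quotient S.G ii) \<epsilon> \<omega> {1..d} (quotient_image S.G ii hh)
      (\<lambda>l. ii +>\<^bsub>S.G\<^esub> Y (kin_to_red l))"
    by (auto intro!: galilean.intro galilean_axioms.intro
        simp: galilean_klein_pair_def kinematical_klein_pair_def klein_pair_def)
  \<comment> \<open>No separate argument for the quotient: it is galilean, and every galilean pair
    is effective.\<close>
  then have effQ: "effective_klein_pair (lie_quotient S.G ii) (quotient_image S.G ii hh)"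
    by (rule galilean.effective)
  \<comment> \<open>The vector \<open>M\<close> has \<open>M\<close>-coordinate 1, so
    \<open>ii\<close> is non-zero; next, \<open>H\<close> has \<open>H\<close>-coordinate 1, which
    vanishes on \<open>ii\<close>, so \<open>ii\<close> is proper.\<close>
  have "E (kP 0) \<noteq> \<zero>\<^bsub>L\<^esub>"
    using Y.coord_E[of rM rM] Y.coord_zero[of rM] by auto
  then have "ii \<noteq> {\<zero>\<^bsub>L\<^esub>}" using gen_i(1) by auto
  moreover have "E kH \<notin> ii"
    using Y.coord_E[of rH rH] Y.coord_span_zero[OF _ red_labels_i_subset, of "E kH" rH]
    unfolding ii_def by (auto simp: red_labels_i_def)
  then have "ii \<noteq> carrier L" using L.generators_carrier(1) by auto
  ultimately have proj: "projectable_triplet S.G hh ii"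
    using G.effective ideal effQ by (simp add: projectable_triplet_def)
  have "lifts S.G hh ii N hN" if "galilean_klein_pair \<epsilon> \<omega> N {1..d} hN Z" for N :: "'b lie_algebra" and hN Z
    using proj galilean_isomorphic[OF galQ that] that
    unfolding lifts_def galilean_klein_pair_def kinematical_klein_pair_def by blast
  then show ?thesis
    unfolding Let_def Y_def[symmetric] kk_def[symmetric] ii_def[symmetric]
    using red split sub proj redG comm galQ by blast
qed

end
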